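(* Let $t\ge2$ and $1\le m<t$ be integers. Then for all $x\in\mathbb{C}\setminus\{0\}$, $$\begin{aligned}(q)^3_{\infty}f_{t,m}(x) = \sum_{k=0}^{2t-1}&(-1)^k q^{\binom{k}{2}+k} \Big(f_{1,4t-1,1}(q^{2t+k-m}, q^{1+m+k}; q) + q^{2t+k}f_{1,4t-1,1}(q^{4t+k-m}, q^{2t+m+k+1}; q)\Big) \\ &\times f_{1,2t,2t(2t-1)}(x^{-1}q^{k+1}, -q^{(k+t)(2t-1)}; q).\end{aligned}$$
   Context: Throughout, $q\in\mathbb{C}$ with $0<|q|<1$. $(x)_\infty=(x;q)_\infty=\prod_{i\ge0}(1-xq^i)$, so $(q)_\infty=\prod_{i\ge 1}(1-q^i)$. $\Theta(x;q)=(x)_\infty(q/x)_\infty(q)_\infty=\sum_{n\in\mathbb{Z}}(-1)^nq^{\binom n2}x^n$. $\mathrm{sg}(r)=1$ if $r\ge0$ and $-1$ if $r<0$; $\mathrm{sg}(r,s)=\frac{\mathrm{sg}(r)+\mathrm{sg}(s)}{2}$. For integers $t\geq 1$, $m$ define $$g_{t,m}(x) = \sum_{\substack{r,s\in\mathbb{Z}\\ r\equiv s\ (\mathrm{mod}\ 2)}} \mathrm{sg}(r,s) \frac{(-1)^{\frac{r-s}{2}}q^{\frac{r^2}{8}+\frac{4t-1}{4}rs+\frac{s^2}{8}+\frac{4t-1-2m}{4}r+\frac{1+2m}{4}s}}{1-xq^{\frac{r+s}{2}}},\qquad f_{t,m}(x)=\frac{\Theta(x;q)}{(q)_\infty^3}g_{t,m}(x),$$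 where $f_{t,m}$ (two indices) is regarded as a function on $\mathbb{C}\setminus\{0\}$ (it has no poles; values at integer powers of $q$ are given by the holomorphic extension). For positive integers $a,b,c$ with $b^2-ac>0$, the Hecke-type double-sum (three indices) is $$f_{a,b,c}(x,y;q) = \sum_{r,s \in \mathbb{Z}} \mathrm{sg}(r,s) (-1)^{r+s} x^r y^s q^{a\binom{r}{2}+brs+c\binom{s}{2}},\qquad \binom n2=\frac{n(n-1)}{2}.$$ *)

theory Defs
  imports "HOL-Complex_Analysis.Complex_Analysis"
begin

definition qpoch_inf :: "complex \<Rightarrow> complex \<Rightarrow> complex" where
  "qpoch_inf x q = (\<Prod>i. 1 - x * q ^ i)"

definition jtheta :: "complex \<Rightarrow> complex \<Rightarrow> complex" where
  "jtheta x q = qpoch_inf x q * qpoch_inf (q / x) q * qpoch_inf q q"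

definition sg :: "int \<Rightarrow> complex" where
  "sg r = (if r \<ge> 0 then 1 else -1)"

definition sg2 :: "int \<Rightarrow> int \<Rightarrow> complex" where
  "sg2 r s = (sg r + sg s) / 2"

definition binom2 :: "int \<Rightarrow> int" where
  "binom2 n = n * (n - 1) div 2"

text \<open>
  The exponent \<open>r^2/8 + (4t-1)/4 rs + s^2/8 + (4t-1-2m)/4 r + (1+2m)/4 s\<close> over the common
  denominator 8.  The division is exact for \<open>r\<close>, \<open>s\<close> of equal parity, see \<open>g_exp_exact\<close> below,
  so no choice of a root of \<open>q\<close> is involved.
\<close>
definition g_exp :: "int \<Rightarrow> int \<Rightarrow> int \<Rightarrow> int \<Rightarrow> int" where
  "g_exp t m r s =
     (r^2 + 2 * (4*t - 1) * r * s + s^2 + 2 * (4*t - 1 - 2*m) * r + 2 * (1 + 2*m) * s) div 8"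

lemma g_exp_exact:
  assumes "r mod 2 = s mod 2"
  shows "real_of_int (g_exp t m r s) =
           r^2 / 8 + (4*t - 1) / 4 * r * s + s^2 / 8 + (4*t - 1 - 2*m) / 4 * r + (1 + 2*m) / 4 * s"
proof -
  have "even (r - s)"
    using assms by presburger
  then obtain k where r: "r = s + 2 * k"
    by (metis dvd_def add.commute diff_add_cancel)
  have "even (k * (k - 1))"
    by simp
  then obtain j where j: "k * (k - 1) = 2 * j"
    by (rule dvdE)
  let ?n = "r^2 + 2 * (4*t - 1) * r * s + s^2 + 2 * (4*t - 1 - 2*m) * r + 2 * (1 + 2*m) * s"
  have "?n = 4 * (k * (k - 1)) + 8 * (t * r * s + t * r - m * k)"
    unfolding r by (simp add: algebra_simps power2_eq_square)
  also have "\<dots> = 8 * (j + t * r * s + t * r - m * k)"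
    unfolding j by simp
  finally have n: "?n = 8 * g_exp t m r s"
    unfolding g_exp_def by simp
  have "real_of_int ?n = 8 * real_of_int (g_exp t m r s)"
    unfolding n by simp
  then show ?thesis
    by (simp add: field_simps)
qed

definition g_sum :: "int \<Rightarrow> int \<Rightarrow> complex \<Rightarrow> complex \<Rightarrow> complex" where
  "g_sum t m q x =
     (\<Sum>\<^sub>\<infinity>(r, s) \<in> {(r, s). r mod 2 = s mod 2}.
        sg2 r s * ((-1) powi ((r - s) div 2) * q powi g_exp t m r s)
          / (1 - x * q powi ((r + s) div 2)))"

definition f_raw :: "int \<Rightarrow> int \<Rightarrow> complex \<Rightarrow> complex \<Rightarrow> complex" where
  "f_raw t m q x = jtheta x q / qpoch_inf q q ^ 3 * g_sum t m q x"

text \<open>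
  The formula \<open>f_raw\<close> makes sense only off the integer powers of \<open>q\<close>; at those points
  (removable singularities) the value is that of the holomorphic extension.
\<close>
definition f_ext :: "int \<Rightarrow> int \<Rightarrow> complex \<Rightarrow> complex \<Rightarrow> complex" where
  "f_ext t m q x =
     (if x \<in> range (\<lambda>n::int. q powi n) then remove_sings (f_raw t m q) x else f_raw t m q x)"

definition hecke_f :: "int \<Rightarrow> int \<Rightarrow> int \<Rightarrow> complex \<Rightarrow> complex \<Rightarrow> complex \<Rightarrow> complex" where
  "hecke_f a b c x y q =
     (\<Sum>\<^sub>\<infinity>(r, s) \<in> UNIV.
        sg2 r s * (-1) powi (r + s) * x powi r * y powi s
          * q powi (a * binom2 r + b * r * s + c * binom2 s))"

end

theory Submission
  imports Defs
begin

text \<open>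
  Pairs of equal parity are written as \<open>r = n + j\<close>, \<open>s = n - j\<close>. In these coordinates the summand of
  \<open>g_sum\<close> is a weight \<open>w(n, j)\<close>, supported on a double cone \<open>\<bar>j\<bar> \<le> \<bar>n\<bar>\<close>, divided
  by \<open>1 - x * q powi n\<close>. The identity comes from multiplying with \<open>jtheta x q\<close> before summing.

  First, \<open>jtheta x q / (1 - x * q powi n)\<close> has a holomorphic extension to the punctured plane, since theta
  functions vanish at powers of \<open>q\<close>, and its Laurent coefficients are partial sums of theta series. This gives an
  absolutely convergent sum over \<open>r\<close> and \<open>l\<close> of equal sign, whose terms depend on \<open>n\<close> only
  through \<open>q powi (n * l)\<close> (\<open>theta_quotient_expansion\<close>; it rests on the Jacobi triple product
  \<open>jacobi_triple_product\<close>). Interchanging the summations (\<open>theta_times_g_sum\<close>) expresses the product of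
  \<open>jtheta x q\<close> and \<open>g_sum\<close> as a sum over \<open>r\<close> and \<open>l\<close> whose coefficients contain the moments
  \<open>A(l) = \<Sum> w(n, j) * q powi (l * n)\<close>. The interchange needs absolute convergence of a fourfold sum,
  which is borderline and uses \<open>1 \<le> m < t\<close> (\<open>total_exponent_lower_bound\<close>).

  Second, shifting \<open>n\<close> by one shows that \<open>A(l + 2 * t) = q powi (- 2 * t - l) * A(l)\<close>
  exactly: the boundary terms of the cone are theta functions at powers of \<open>q\<close> and so vanish
  (\<open>moment_shift\<close>). Hence, with \<open>l = k + 2 * t * s\<close> and \<open>0 \<le> k < 2 * t\<close>, the sum over
  \<open>r\<close> and \<open>l\<close> splits into \<open>2 * t\<close> sums over \<open>r\<close> and \<open>s\<close>, each of which is, up to sign and a power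
  of \<open>q\<close>, \<open>A(k)\<close> times a Hecke-type sum in \<open>1 / x\<close> (\<open>residue_class_term\<close>).

  Third, \<open>A(k)\<close> is itself a sum of two Hecke-type sums, one for each common parity of \<open>r\<close> and
  \<open>s\<close> (\<open>moment_eq_hecke\<close>).

  All this holds off the integer powers of \<open>q\<close>. The right-hand side is continuous on the punctured plane and
  those powers are isolated, so it also gives the value of the holomorphic extension there
  (\<open>f_ext_eq\<close>).
\<close>

section \<open>Sums over the integers\<close>

lemma two_binom2: "2 * binom2 n = n * (n - 1)"
  by (simp add: binom2_def)

lemma two_times_binom2: "2 * (c * binom2 n) = c * (n * (n - 1))"
  by (simp flip: two_binom2)

lemma binom2_plus1: "binom2 (n + 1) = binom2 n + n"
  using two_binom2[of n] two_binom2[of "n + 1"] by (simp add: algebra_simps)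

lemma binom2_minus: "binom2 (- n) = binom2 n + n"
  using two_binom2[of n] two_binom2[of "- n"] by (simp add: algebra_simps)

lemma powi_add: "a \<noteq> 0 \<Longrightarrow> a powi (m + n) = a powi m * a powi n" for a :: "'a :: field"
  by (simp add: power_int_add)

lemma minus1_powi_cong: "even (a - b) \<Longrightarrow> (-1 :: complex) powi a = (-1) powi b"
  by (auto simp: power_int_minus_left)

text \<open>
  Dominated convergence for unordered sums along an arbitrary filter. It is used twice: along
  \<open>sequentially\<close> to let the finite Jacobi product tend to the infinite one, and along
  \<open>at z\<close> to see that the final double sum is continuous in its argument.
\<close>
lemma infsum_tendsto_dominated:
  fixes f :: "'a \<Rightarrow> 'b \<Rightarrow> 'c :: banach"
  assumes lim: "\<And>k. k \<in> A \<Longrightarrow> ((\<lambda>n. f n k) \<longlongrightarrow> g k) F"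
    and bound: "\<forall>\<^sub>F n in F. \<forall>k\<in>A. norm (f n k) \<le> M k"
    and M: "M summable_on A" and F: "F \<noteq> bot"
  shows "((\<lambda>n. \<Sum>\<^sub>\<infinity>k\<in>A. f n k) \<longlongrightarrow> (\<Sum>\<^sub>\<infinity>k\<in>A. g k)) F"
proof (rule swap_uniform_limit')
  have g_le: "norm (g k) \<le> M k" if "k \<in> A" for k
  proof (rule tendsto_upperbound[OF tendsto_norm[OF lim[OF that]] _ F])
    show "\<forall>\<^sub>F n in F. norm (f n k) \<le> M k"
      using bound by eventually_elim (use that in auto)
  qed
  have "g summable_on A"
    by (rule abs_summable_summable[OF Infinite_Sum.abs_summable_on_comparison_test'[OF M g_le]])
  then show "(sum g \<longlongrightarrow> (\<Sum>\<^sub>\<infinity>k\<in>A. g k)) (finite_subsets_at_top A)"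
    by (rule infsum_tendsto)
  show "uniform_limit {n. \<forall>k\<in>A. norm (f n k) \<le> M k} (\<lambda>X n. \<Sum>k\<in>X. f n k)
          (\<lambda>n. \<Sum>\<^sub>\<infinity>k\<in>A. f n k) (finite_subsets_at_top A)"
    by (rule Weierstrass_m_test_general[OF _ M]) auto
  show "\<forall>\<^sub>F X in finite_subsets_at_top A. ((\<lambda>n. \<Sum>k\<in>X. f n k) \<longlongrightarrow> sum g X) F"
    by (rule eventually_finite_subsets_at_top_weakI) (auto intro!: tendsto_sum lim)
  show "\<forall>\<^sub>F n in F. n \<in> {n. \<forall>k\<in>A. norm (f n k) \<le> M k}"
    using bound by simp
qed simp

lemma summable_on_int_halves:
  fixes f :: "int \<Rightarrow> real"
  assumes "\<And>n. 0 \<le> f n" "summable (\<lambda>n. f (int n))" "summable (\<lambda>n. f (- int n))"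
  shows "f summable_on UNIV"
proof -
  have *: "(\<lambda>n. f (g n)) summable_on UNIV \<Longrightarrow> inj g \<Longrightarrow> f summable_on range g" for g :: "nat \<Rightarrow> int"
    by (subst summable_on_reindex) (auto simp: o_def)
  have "f summable_on range int" "f summable_on range (\<lambda>n. - int n)"
    using assms by (auto intro!: * injI simp: summable_on_UNIV_nonneg_real_iff)
  then have "f summable_on (range int \<union> range (\<lambda>n. - int n))"
    by (rule summable_on_union)
  also have "range int \<union> range (\<lambda>n. - int n) = UNIV"
    by (auto simp: image_iff) (metis int_cases2)
  finally show ?thesis .
qed

lemma geometric_summable_int:
  fixes \<rho> :: real
  assumes "0 \<le> \<rho>" "\<rho> < 1"
  shows "(\<lambda>n::int. \<rho> ^ nat \<bar>n\<bar>) summable_on UNIV"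
  using assms by (intro summable_on_int_halves) (auto intro!: summable_geometric)

text \<open>
  The ratio of consecutive terms is \<open>z * Q ^ n\<close>, which tends to \<open>0\<close>, however large \<open>z\<close> is.
\<close>
lemma theta_summable_nat:
  fixes Q z :: real
  assumes "0 < Q" "Q < 1" "0 < z"
  shows "summable (\<lambda>n. z ^ n * Q powi binom2 (int n))"
proof -
  have "(\<lambda>n. z * Q ^ n) \<longlonglongrightarrow> z * 0"
    using assms by (intro tendsto_intros LIMSEQ_realpow_zero) auto
  then have "\<forall>\<^sub>F n in sequentially. z * Q ^ n < 1 / 2"
    by (rule order_tendstoD) auto
  then obtain N where N: "\<And>n. n \<ge> N \<Longrightarrow> z * Q ^ n < 1 / 2"
    by (auto simp: eventually_sequentially)
  show ?thesis
  proof (rule summable_ratio_test[of "1/2" N])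
    fix n assume "n \<ge> N"
    have "binom2 (int (Suc n)) = binom2 (int n) + int n"
      using binom2_plus1[of "int n"] by (simp add: add.commute)
    then have "z ^ Suc n * Q powi binom2 (int (Suc n)) = (z * Q ^ n) * (z ^ n * Q powi binom2 (int n))"
      using assms by (simp add: powi_add)
    also have "\<dots> \<le> 1 / 2 * (z ^ n * Q powi binom2 (int n))"
      using N[OF \<open>n \<ge> N\<close>] assms by (intro mult_right_mono) auto
    finally show "norm (z ^ Suc n * Q powi binom2 (int (Suc n)))
                    \<le> 1 / 2 * norm (z ^ n * Q powi binom2 (int n))"
      using assms by (simp add: abs_mult)
  qed simp
qed

text \<open>
  The half over negative indices is again a sum over \<open>nat\<close> of the same shape, with \<open>z\<close>
  replaced by \<open>Q / z\<close>, because \<open>binom2 (- n) = binom2 n + n\<close>.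
\<close>
lemma theta_summable_real:
  fixes Q z :: real
  assumes "0 < Q" "Q < 1" "0 < z"
  shows "(\<lambda>n::int. z powi n * Q powi binom2 n) summable_on UNIV"
proof (rule summable_on_int_halves)
  show "summable (\<lambda>n. z powi int n * Q powi binom2 (int n))"
    using theta_summable_nat[OF assms] by simp
  have "z powi (- int n) * Q powi binom2 (- int n) = (Q / z) ^ n * Q powi binom2 (int n)" for n
    using assms by (simp add: binom2_minus powi_add power_int_minus field_simps)
  then show "summable (\<lambda>n. z powi (- int n) * Q powi binom2 (- int n))"
    using theta_summable_nat[of Q "Q / z"] assms by simp
qed (use assms in auto)

lemma theta_summable:
  fixes q z :: complex
  assumes "0 < norm q" "norm q < 1" "z \<noteq> 0"
  shows "(\<lambda>n::int. (-1) powi n * z powi n * q powi binom2 n) summable_on UNIV"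
proof (rule abs_summable_summable, rule Infinite_Sum.abs_summable_on_comparison_test')
  show "(\<lambda>n::int. norm z powi n * norm q powi binom2 n) summable_on UNIV"
    using assms by (intro theta_summable_real) auto
qed (simp add: norm_mult norm_power_int)

section \<open>Theta functions and the Jacobi triple product\<close>

text \<open>
  A theta function vanishes at the integer powers of its nome: the reflection
  \<open>n \<mapsto> 1 - 2 * c - n\<close> preserves the exponent, which is a parabola symmetric about
  \<open>1 / 2 - c\<close>, and reverses the sign. Every boundary sum that has to
  disappear below does so for this reason.
\<close>
lemma theta_at_power_eq_0:
  fixes q :: complex
  assumes "q \<noteq> 0"
  shows "(\<Sum>\<^sub>\<infinity>n. (-1) powi n * q powi (binom2 n + c * n)) = 0"
proof -
  have e: "binom2 (1 - 2 * c - n) + c * (1 - 2 * c - n) = binom2 n + c * n" for n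
    using two_binom2[of n] two_binom2[of "1 - 2 * c - n"] by (simp add: algebra_simps)
  have s: "(-1 :: complex) powi (1 - 2 * c - n) = - ((-1) powi n)" for n
    using minus1_powi_cong[of "1 - 2 * c - n" "n + 1"] by (simp add: powi_add)
  have "(\<Sum>\<^sub>\<infinity>n. (-1) powi n * q powi (binom2 n + c * n))
      = (\<Sum>\<^sub>\<infinity>n. - ((-1) powi n * q powi (binom2 n + c * n)))"
    by (rule infsum_reindex_bij_witness[of _ "\<lambda>n. 1 - 2 * c - n" "\<lambda>n. 1 - 2 * c - n"])
      (simp_all add: e s)
  then show ?thesis
    by (simp add: infsum_uminus)
qed

definition qfact :: "complex \<Rightarrow> nat \<Rightarrow> complex" where
  "qfact q n = (\<Prod>i<n. 1 - q ^ Suc i)"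

text \<open>
  With the value \<open>0\<close> at negative arguments, which is the convention that reciprocals of
  \<open>(q)\<^sub>a\<close> obey, the recursion \<open>inv_qfact_pred\<close> holds for every integer, and the sums below need no
  explicit bounds.
\<close>
definition inv_qfact :: "complex \<Rightarrow> int \<Rightarrow> complex" where
  "inv_qfact q a = (if a < 0 then 0 else inverse (qfact q (nat a)))"

text \<open>
  Up to sign and power of \<open>q\<close> this is the Gaussian binomial coefficient of \<open>2 * N\<close> over
  \<open>N + k\<close>.
\<close>
definition jacobi_coeff :: "complex \<Rightarrow> nat \<Rightarrow> int \<Rightarrow> complex" where
  "jacobi_coeff q N k = (-1) powi k * q powi binom2 k
     * (qfact q (2 * N) * inv_qfact q (int N - k) * inv_qfact q (int N + k))"

context
  fixes q :: complex
  assumes q: "0 < norm q" "norm q < 1"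
begin

lemma one_minus_power_neq_0: "1 - q ^ Suc n \<noteq> 0"
proof
  assume "1 - q ^ Suc n = 0"
  then have "q ^ Suc n = 1"
    by simp
  then have "norm q ^ Suc n = 1"
    by (metis norm_one norm_power)
  moreover have "norm q ^ Suc n < 1"
    using q by (simp only: power_less_one_iff) auto
  ultimately show False
    by simp
qed

lemma qfact_neq_0: "qfact q n \<noteq> 0"
  unfolding qfact_def using one_minus_power_neq_0 by simp

lemma inv_qfact_pred: "inv_qfact q (a - 1) = (1 - q powi a) * inv_qfact q a"
proof (cases "a > 0")
  case True
  define n where "n = nat (a - 1)"
  have a: "a = int (Suc n)"
    using True by (simp add: n_def)
  show ?thesis
    using qfact_neq_0[of n] one_minus_power_neq_0[of n]
    unfolding a power_int_of_nat by (simp add: inv_qfact_def qfact_def nat_add_distrib field_simps)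
qed (auto simp: inv_qfact_def)

text \<open>
  This is the recursion forced by multiplying the product of length \<open>N\<close> with the two new factors
  \<open>(1 - x * q ^ N) * (1 - q ^ (N + 1) / x)\<close>. Writing \<open>a\<close> and \<open>b\<close> for the two powers
  \<open>q powi (N + 1 - k)\<close> and \<open>q powi (N + 1 + k)\<close>, whose product is \<open>q ^ (2 * N + 2)\<close>, every
  coefficient becomes a common factor times a polynomial in \<open>a\<close>, \<open>b\<close> and \<open>1 / q\<close>.
\<close>
lemma jacobi_coeff_Suc:
  "jacobi_coeff q (Suc N) k = (1 + q ^ (2 * N + 1)) * jacobi_coeff q N k
     - q ^ N * jacobi_coeff q N (k - 1) - q ^ (N + 1) * jacobi_coeff q N (k + 1)"
proof -
  have q0: "q \<noteq> 0"
    using q by auto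
  define a where "a = q powi (int N + 1 - k)"
  define b where "b = q powi (int N + 1 + k)"
  define u where "u = inv_qfact q (int N + 1 - k)"
  define v where "v = inv_qfact q (int N + 1 + k)"
  define S where "S = (-1) powi k * q powi binom2 k * qfact q (2 * N)"
  have u1: "inv_qfact q (int N - k) = (1 - a) * u"
    using inv_qfact_pred[of "int N + 1 - k"] by (simp add: a_def u_def)
  have v1: "inv_qfact q (int N + k) = (1 - b) * v"
    using inv_qfact_pred[of "int N + 1 + k"] by (simp add: b_def v_def add.commute)
  have u2: "inv_qfact q (int N - (k + 1)) = (1 - a / q) * (1 - a) * u"
  proof -
    have "q powi (int N - k) = a / q"
      using q0 by (simp add: a_def power_int_diff power_int_add)
    then show ?thesis
      using inv_qfact_pred[of "int N - k"] by (simp add: u1 diff_diff_eq)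
  qed
  have v2: "inv_qfact q (int N + (k - 1)) = (1 - b / q) * (1 - b) * v"
  proof -
    have "q powi (int N + k) = b / q"
      using q0 by (simp add: b_def power_int_add)
    then show ?thesis
      using inv_qfact_pred[of "int N + k"] by (simp add: v1 add_diff_eq)
  qed
  have ab: "a * b = q ^ (2 * N + 2)"
    using q0 powi_add[of q "int N + 1 - k" "int N + 1 + k"] power_int_of_nat[of q "2 * N + 2"]
    by (simp add: a_def b_def algebra_simps)
  have ab1: "a * b / q = q ^ (2 * N + 1)"
    using ab q0 by simp
  have F: "qfact q (2 * Suc N) = (1 - a * b / q) * (1 - a * b) * qfact q (2 * N)"
    unfolding ab ab1 by (simp add: qfact_def algebra_simps)
  have L: "jacobi_coeff q (Suc N) k = S * u * v * ((1 - a * b / q) * (1 - a * b))"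
    unfolding jacobi_coeff_def F by (simp add: S_def u_def v_def algebra_simps)
  have M: "jacobi_coeff q N k = S * u * v * ((1 - a) * (1 - b))"
    unfolding jacobi_coeff_def u1 v1 by (simp add: S_def algebra_simps)
  have bk: "binom2 k = binom2 (k - 1) + (k - 1)"
    using binom2_plus1[of "k - 1"] by simp
  have c1: "q ^ N * ((-1) powi (k - 1) * q powi binom2 (k - 1)) = - ((-1) powi k * q powi binom2 k * a)"
    using q0 by (simp add: a_def bk power_int_diff power_int_add field_simps)
  have u3: "inv_qfact q (int N - (k - 1)) = u"
    by (simp add: u_def algebra_simps)
  have "q ^ N * jacobi_coeff q N (k - 1)
      = q ^ N * ((-1) powi (k - 1) * q powi binom2 (k - 1))
          * (qfact q (2 * N) * u * ((1 - b / q) * (1 - b) * v))"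
    unfolding jacobi_coeff_def v2 u3 by simp
  then have D: "q ^ N * jacobi_coeff q N (k - 1) = - (S * u * v * (a * (1 - b / q) * (1 - b)))"
    unfolding c1 S_def by simp
  have c2: "q ^ (N + 1) * ((-1) powi (k + 1) * q powi binom2 (k + 1)) = - ((-1) powi k * q powi binom2 k * b)"
    unfolding binom2_plus1 using q0 by (simp add: b_def power_int_add field_simps)
  have v3: "inv_qfact q (int N + (k + 1)) = v"
    by (simp add: v_def algebra_simps)
  have "q ^ (N + 1) * jacobi_coeff q N (k + 1)
      = q ^ (N + 1) * ((-1) powi (k + 1) * q powi binom2 (k + 1))
          * (qfact q (2 * N) * ((1 - a / q) * (1 - a) * u) * v)"
    unfolding jacobi_coeff_def u2 v3 by simp
  then have U: "q ^ (N + 1) * jacobi_coeff q N (k + 1) = - (S * u * v * (b * (1 - a / q) * (1 - a)))"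
    unfolding c2 S_def by simp
  show ?thesis
    unfolding L M D U ab1[symmetric] using q0 by (simp add: field_simps)
qed

lemma finite_jacobi_product:
  assumes "x \<noteq> 0"
  shows "((\<lambda>k. jacobi_coeff q N k * x powi k) has_sum
            ((\<Prod>i<N. 1 - x * q ^ i) * (\<Prod>i<N. 1 - q / x * q ^ i))) UNIV"
proof (induction N)
  case 0
  have "jacobi_coeff q 0 k * x powi k = (if k = 0 then 1 else 0)" for k
    by (auto simp: jacobi_coeff_def inv_qfact_def qfact_def binom2_def)
  moreover have "((\<lambda>k::int. if k = 0 then 1 else 0 :: complex) has_sum 1) UNIV"
    by (rule has_sum_finite_neutralI[of "{0}"]) auto
  ultimately show ?case
    by simp
next
  case (Suc N)
  define p where "p = (\<Prod>i<N. 1 - x * q ^ i) * (\<Prod>i<N. 1 - q / x * q ^ i)"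
  have S0: "((\<lambda>k. jacobi_coeff q N k * x powi k) has_sum p) UNIV"
    using Suc.IH by (simp add: p_def)
  have shift: "((\<lambda>k. jacobi_coeff q N (k - c) * x powi (k - c)) has_sum p) UNIV" for c
    using S0 by (subst has_sum_reindex_bij_witness[of UNIV "\<lambda>k. k + c" "\<lambda>k. k - c"]) auto
  have "((\<lambda>k. (1 + q ^ (2 * N + 1)) * (jacobi_coeff q N k * x powi k)
            + (- (q ^ N) * x) * (jacobi_coeff q N (k - 1) * x powi (k - 1))
            + (- (q ^ (N + 1)) / x) * (jacobi_coeff q N (k - (- 1)) * x powi (k - (- 1)))) has_sum
          (1 + q ^ (2 * N + 1)) * p + (- (q ^ N) * x) * p + (- (q ^ (N + 1)) / x) * p) UNIV"
    by (intro has_sum_add has_sum_cmult_right S0 shift)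
  also have "(\<lambda>k. (1 + q ^ (2 * N + 1)) * (jacobi_coeff q N k * x powi k)
            + (- (q ^ N) * x) * (jacobi_coeff q N (k - 1) * x powi (k - 1))
            + (- (q ^ (N + 1)) / x) * (jacobi_coeff q N (k - (- 1)) * x powi (k - (- 1))))
          = (\<lambda>k. jacobi_coeff q (Suc N) k * x powi k)"
    using assms by (auto simp: jacobi_coeff_Suc power_int_diff power_int_add field_simps)
  also have "(1 + q ^ (2 * N + 1)) * p + (- (q ^ N) * x) * p + (- (q ^ (N + 1)) / x) * p
          = p * ((1 - x * q ^ N) * (1 - q / x * q ^ N))"
    using assms by (simp add: field_simps power_add power2_eq_square mult_2 mult_2_right)
  finally show ?case
    by (simp add: p_def mult_ac)
qed

lemma convergent_qpoch: "convergent_prod (\<lambda>i. 1 - x * q ^ i)"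
proof -
  have "summable (\<lambda>i. norm (x * q ^ i))"
    using q by (simp add: norm_mult norm_power summable_mult summable_geometric)
  then show ?thesis
    by (intro abs_convergent_prod_imp_convergent_prod)
      (simp add: abs_convergent_prod_conv_summable)
qed

lemma qpoch_LIMSEQ: "(\<lambda>N. \<Prod>i<N. 1 - x * q ^ i) \<longlonglongrightarrow> qpoch_inf x q"
  using convergent_prod_LIMSEQ[OF convergent_qpoch[of x]]
  by (subst LIMSEQ_lessThan_iff_atMost) (simp add: qpoch_inf_def)

lemma qfact_LIMSEQ: "qfact q \<longlonglongrightarrow> qpoch_inf q q"
  using qpoch_LIMSEQ[of q] by (simp add: qfact_def[abs_def])

lemma qpoch_inf_self_neq_0: "qpoch_inf q q \<noteq> 0"
  unfolding qpoch_inf_def using one_minus_power_neq_0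
  by (intro prodinf_nonzero convergent_qpoch) auto

text \<open>
  The coefficients of the finite product converge to those of the theta series divided by
  \<open>qpoch_inf q q\<close>, and they are dominated by a convergent theta series because \<open>qfact q\<close> and its
  reciprocal are bounded.
\<close>
theorem jacobi_triple_product:
  assumes x: "x \<noteq> 0"
  shows "(\<Sum>\<^sub>\<infinity>k. (-1) powi k * x powi k * q powi binom2 k) = jtheta x q"
proof -
  define Q where "Q = qpoch_inf q q"
  have Q0: "Q \<noteq> 0"
    using qpoch_inf_self_neq_0 by (simp add: Q_def)
  have qf: "qfact q \<longlonglongrightarrow> Q"
    using qfact_LIMSEQ by (simp add: Q_def)
  have inv: "(\<lambda>n. inverse (qfact q n)) \<longlonglongrightarrow> inverse Q"
    by (intro tendsto_inverse qf Q0)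
  obtain B where B: "\<And>n. norm (qfact q n) \<le> B" and "B > 0"
    using qf convergent_imp_Bseq BseqE convergentI by metis
  obtain C where C': "\<And>n. norm (inverse (qfact q n)) \<le> C" and "C > 0"
    using inv convergent_imp_Bseq BseqE convergentI by metis
  have C: "norm (inv_qfact q a) \<le> C" for a
    using C' \<open>C > 0\<close> by (simp add: inv_qfact_def)
  have shift: "(\<lambda>N. inv_qfact q (int N + k)) \<longlonglongrightarrow> inverse Q" for k
  proof (rule Lim_transform_eventually)
    have "filterlim (\<lambda>N. nat (int N + k)) at_top sequentially"
      unfolding filterlim_at_top
    proof
      fix Z
      show "\<forall>\<^sub>F N in sequentially. Z \<le> nat (int N + k)"
        using eventually_ge_at_top[of "Z + nat \<bar>k\<bar>"] by eventually_elim linarith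
    qed
    then show "(\<lambda>N. inverse (qfact q (nat (int N + k)))) \<longlonglongrightarrow> inverse Q"
      by (rule filterlim_compose[OF inv])
    show "\<forall>\<^sub>F N in sequentially. inverse (qfact q (nat (int N + k))) = inv_qfact q (int N + k)"
      using eventually_ge_at_top[of "nat \<bar>k\<bar>"]
      by eventually_elim (auto simp: inv_qfact_def)
  qed
  have dbl: "(\<lambda>N. qfact q (2 * N)) \<longlonglongrightarrow> Q"
    using LIMSEQ_subseq_LIMSEQ[OF qf, of "\<lambda>N. 2 * N"] by (simp add: strict_mono_def o_def)
  have term_lim: "(\<lambda>N. jacobi_coeff q N k * x powi k)
        \<longlonglongrightarrow> (-1) powi k * q powi binom2 k * (Q * inverse Q * inverse Q) * x powi k" for k
    unfolding jacobi_coeff_def using shift[of k] shift[of "- k"] dbl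
    by (intro tendsto_intros) simp_all
  have "(\<lambda>N. \<Sum>\<^sub>\<infinity>k. jacobi_coeff q N k * x powi k)
      \<longlonglongrightarrow> (\<Sum>\<^sub>\<infinity>k. (-1) powi k * q powi binom2 k * (Q * inverse Q * inverse Q) * x powi k)"
  proof (rule infsum_tendsto_dominated[OF term_lim])
    show "(\<lambda>k. B * C * C * (norm x powi k * norm q powi binom2 k)) summable_on UNIV"
      using q x by (intro summable_on_cmult_right theta_summable_real) auto
    have "norm (jacobi_coeff q N k * x powi k) \<le> B * C * C * (norm x powi k * norm q powi binom2 k)" for N k
    proof -
      have "norm (qfact q (2 * N) * inv_qfact q (int N - k) * inv_qfact q (int N + k)) \<le> B * C * C"
        using \<open>B > 0\<close> \<open>C > 0\<close> by (auto simp: norm_mult intro!: mult_mono B C)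
      then have "norm (qfact q (2 * N) * inv_qfact q (int N - k) * inv_qfact q (int N + k))
          * (norm x powi k * norm q powi binom2 k) \<le> B * C * C * (norm x powi k * norm q powi binom2 k)"
        by (intro mult_right_mono) auto
      then show ?thesis
        by (simp add: jacobi_coeff_def norm_mult norm_power_int mult_ac)
    qed
    then show "\<forall>\<^sub>F N in sequentially. \<forall>k\<in>UNIV. norm (jacobi_coeff q N k * x powi k)
        \<le> B * C * C * (norm x powi k * norm q powi binom2 k)"
      by simp
  qed auto
  also have "(\<lambda>N. \<Sum>\<^sub>\<infinity>k. jacobi_coeff q N k * x powi k)
      = (\<lambda>N. (\<Prod>i<N. 1 - x * q ^ i) * (\<Prod>i<N. 1 - q / x * q ^ i))"
    using infsumI[OF finite_jacobi_product[OF x]] by auto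
  finally have "(\<lambda>N. (\<Prod>i<N. 1 - x * q ^ i) * (\<Prod>i<N. 1 - q / x * q ^ i))
      \<longlonglongrightarrow> (\<Sum>\<^sub>\<infinity>k. (-1) powi k * q powi binom2 k * (Q * inverse Q * inverse Q) * x powi k)" .
  moreover have "(\<lambda>N. (\<Prod>i<N. 1 - x * q ^ i) * (\<Prod>i<N. 1 - q / x * q ^ i))
      \<longlonglongrightarrow> qpoch_inf x q * qpoch_inf (q / x) q"
    by (intro tendsto_mult qpoch_LIMSEQ)
  ultimately have "qpoch_inf x q * qpoch_inf (q / x) q
      = (\<Sum>\<^sub>\<infinity>k. (-1) powi k * q powi binom2 k * (Q * inverse Q * inverse Q) * x powi k)"
    by (rule LIMSEQ_unique[symmetric])
  also have "\<dots> = (\<Sum>\<^sub>\<infinity>k. inverse Q * ((-1) powi k * x powi k * q powi binom2 k))"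
    using Q0 by (simp add: field_simps)
  also have "\<dots> = inverse Q * (\<Sum>\<^sub>\<infinity>k. (-1) powi k * x powi k * q powi binom2 k)"
    by (rule infsum_cmult_right')
  finally show ?thesis
    using Q0 by (simp add: jtheta_def Q_def[symmetric] field_simps)
qed

end

lemma theta_at_power_has_sum:
  fixes q :: complex
  assumes "0 < norm q" "norm q < 1"
  shows "((\<lambda>n. (-1) powi n * q powi (binom2 n + c * n)) has_sum 0) UNIV"
proof -
  have q0: "q \<noteq> 0"
    using assms by auto
  have eq: "(-1) powi n * (q powi c) powi n * q powi binom2 n = (-1) powi n * q powi (binom2 n + c * n)" for n
    using q0 by (simp add: power_int_add power_int_mult)
  have "(\<lambda>n. (-1) powi n * q powi (binom2 n + c * n)) summable_on UNIV"
    using theta_summable[OF assms, of "q powi c"] q0 unfolding eq by simp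
  then show ?thesis
    using theta_at_power_eq_0[OF q0, of c] by (simp add: has_sum_iff)
qed

section \<open>Dividing a theta function by a linear factor\<close>

lemma sg2_eq: "sg2 r s = (if r \<ge> 0 \<and> s \<ge> 0 then 1 else if r < 0 \<and> s < 0 then -1 else 0)"
  by (auto simp: sg2_def sg_def)

lemma summable_on_product:
  fixes f :: "'a \<Rightarrow> real" and g :: "'b \<Rightarrow> real"
  assumes "f summable_on A" "g summable_on B" "\<And>x. 0 \<le> f x" "\<And>y. 0 \<le> g y"
  shows "(\<lambda>(x, y). f x * g y) summable_on A \<times> B"
  using assms
  by (intro summable_on_SigmaI[where g = "\<lambda>x. f x * infsum g B"])
    (auto intro!: has_sum_cmult_right summable_on_cmult_left)

text \<open>
  Extending a sum over a line of the plane by zero lets the boundary terms of a shifted double sum be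
  added to it inside one sum.
\<close>
lemma has_sum_row:
  assumes "((\<lambda>r. f r c) has_sum S) UNIV"
  shows "((\<lambda>(r, l). if l = c then f r l else 0) has_sum S) UNIV"
proof -
  have "((\<lambda>(r, l). f r l) has_sum S) (range (\<lambda>r. (r, c)))"
    using assms by (subst has_sum_reindex) (auto simp: inj_def o_def)
  then show ?thesis
    by (rule has_sum_cong_neutral[THEN iffD1, rotated -1]) auto
qed

lemma has_sum_column:
  assumes "((\<lambda>l. f c l) has_sum S) UNIV"
  shows "((\<lambda>(r, l). if r = c then f r l else 0) has_sum S) UNIV"
proof -
  have "((\<lambda>(r, l). f r l) has_sum S) (range (\<lambda>l. (c, l)))"
    using assms by (subst has_sum_reindex) (auto simp: inj_def o_def)
  then show ?thesis
    by (rule has_sum_cong_neutral[THEN iffD1, rotated -1]) auto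
qed

text \<open>
  Up to the signs \<open>sg2 r l\<close> and a factor \<open>q powi (n * l)\<close> these are the terms of the expansion of
  \<open>jtheta x q / (1 - x * q powi n)\<close>. They are indexed such that \<open>r\<close> counts powers of \<open>1 / x\<close>, as
  does the first index of the Hecke-type sum in \<open>1 / x\<close>.
\<close>
definition kernel :: "complex \<Rightarrow> complex \<Rightarrow> int \<Rightarrow> int \<Rightarrow> complex" where
  "kernel x q r l = (-1) powi (r + l) * x powi (- r) * q powi (binom2 (r + 1) + binom2 (l + 1) + r * l)"

context
  fixes q x :: complex
  assumes q: "0 < norm q" "norm q < 1" and x: "x \<noteq> 0"
begin

lemma kernel_row_summable: "(\<lambda>r. norm x powi (- r) * norm q powi binom2 (r + 1)) summable_on UNIV"
proof -
  have "norm x powi (- r) * norm q powi binom2 (r + 1) = (norm q / norm x) powi r * norm q powi binom2 r" for r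
    unfolding binom2_plus1 using q x
    by (simp add: power_int_add power_int_minus power_int_divide_distrib field_simps)
  then show ?thesis
    using theta_summable_real[of "norm q" "norm q / norm x"] q x by simp
qed

lemma kernel_summable: "(\<lambda>(r, l). sg2 r l * (kernel x q r l * q powi (n * l))) summable_on UNIV"
proof (rule abs_summable_summable, rule Infinite_Sum.abs_summable_on_comparison_test')
  have "norm q powi (binom2 (l + 1) + n * l) = (norm q powi (n + 1)) powi l * norm q powi binom2 l" for l
    unfolding power_int_mult[symmetric] binom2_plus1 using q
    by (simp add: power_int_add[symmetric] algebra_simps)
  then have "(\<lambda>l. norm q powi (binom2 (l + 1) + n * l)) summable_on UNIV"
    using theta_summable_real[of "norm q" "norm q powi (n + 1)"] q by simp
  then show "(\<lambda>(r, l). (norm x powi (- r) * norm q powi binom2 (r + 1)) * norm q powi (binom2 (l + 1) + n * l))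
      summable_on UNIV"
    using summable_on_product[OF kernel_row_summable,
      of "\<lambda>l. norm q powi (binom2 (l + 1) + n * l)" UNIV] by simp
  fix p :: "int \<times> int"
  obtain r l where p: "p = (r, l)"
    by force
  show "norm (case p of (r, l) \<Rightarrow> sg2 r l * (kernel x q r l * q powi (n * l)))
      \<le> (case p of (r, l) \<Rightarrow> (norm x powi (- r) * norm q powi binom2 (r + 1)) * norm q powi (binom2 (l + 1) + n * l))"
  proof (cases "sg2 r l = 0")
    case False
    then have rl: "0 \<le> r * l" and s: "norm (sg2 r l) = 1"
      by (auto simp: sg2_eq mult_nonpos_nonpos split: if_splits)
    have "norm q powi (binom2 (r + 1) + (binom2 (l + 1) + n * l) + r * l)
        \<le> norm q powi (binom2 (r + 1) + (binom2 (l + 1) + n * l))"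
      using q rl by (intro power_int_decreasing) auto
    then have "norm x powi (- r) * norm q powi (binom2 (r + 1) + (binom2 (l + 1) + n * l) + r * l)
        \<le> norm x powi (- r) * norm q powi (binom2 (r + 1) + (binom2 (l + 1) + n * l))"
      by (intro mult_left_mono) auto
    then show ?thesis
      using q by (simp add: p kernel_def norm_mult norm_power_int s power_int_add mult_ac)
  qed (use p in auto)
qed

text \<open>
  Multiplication with \<open>x * q powi n\<close> moves the terms along the antidiagonal; this makes the sum in
  \<open>theta_quotient_expansion\<close> telescope.
\<close>
lemma kernel_shift: "x * q powi n * (kernel x q r l * q powi (n * l))
    = kernel x q (r - 1) (l + 1) * q powi (n * (l + 1))"
proof -
  have q0: "q \<noteq> 0"
    using q by auto
  have e: "binom2 (r - 1 + 1) + binom2 (l + 1 + 1) + (r - 1) * (l + 1)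
      = binom2 (r + 1) + binom2 (l + 1) + r * l"
    using binom2_plus1[of r] binom2_plus1[of "l + 1"] by (simp add: algebra_simps)
  show ?thesis
    unfolding kernel_def e using q0 x
    by (simp add: power_int_add power_int_diff power_int_minus field_simps)
qed

text \<open>
  Dividing the theta series by \<open>1 - x * q powi n\<close> termwise gives partial sums of a theta series at an
  integer power of \<open>q\<close>. As the complete sum is \<open>0\<close>, each partial sum has two forms, one over
  \<open>l \<ge> 0\<close> and one over \<open>l < 0\<close>; the form chosen depends on the sign of \<open>r\<close>, which
  makes the double sum converge absolutely.
  
  The proof runs in the opposite direction. Multiplying the double sum with \<open>1 - x * q powi n\<close> leaves,
  by \<open>kernel_shift\<close>, only the terms where \<open>sg2\<close> changes along the antidiagonal: the row
  \<open>l = 0\<close>, which is the theta series of \<open>x\<close>, and the column \<open>r = -1\<close>, which is a theta series at a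
  power of \<open>q\<close> and vanishes.
\<close>
lemma theta_quotient_expansion:
  assumes nz: "1 - x * q powi n \<noteq> 0"
  shows "jtheta x q / (1 - x * q powi n)
      = (\<Sum>\<^sub>\<infinity>(r, l). sg2 r l * (kernel x q r l * q powi (n * l)))"
proof -
  have q0: "q \<noteq> 0"
    using q by auto
  define K where "K = (\<lambda>r l. kernel x q r l * q powi (n * l))"
  define D where "D = (\<Sum>\<^sub>\<infinity>(r, l). sg2 r l * K r l)"
  have D: "((\<lambda>(r, l). sg2 r l * K r l) has_sum D) UNIV"
    using kernel_summable[of n] by (simp add: D_def K_def)
  then have "((\<lambda>p. x * q powi n * (case p of (r, l) \<Rightarrow> sg2 r l * K r l)) has_sum x * q powi n * D) UNIV"
    by (rule has_sum_cmult_right)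
  also have "?this \<longleftrightarrow> ((\<lambda>(r, l). sg2 (r + 1) (l - 1) * K r l) has_sum x * q powi n * D) UNIV"
  proof (rule has_sum_reindex_bij_witness
        [of _ "\<lambda>(r, l). (r + 1, l - 1)" "\<lambda>(r, l). (r - 1, l + 1)"])
    fix p :: "int \<times> int"
    obtain r l where p: "p = (r, l)"
      by force
    show "(case case p of (r, l) \<Rightarrow> (r - 1, l + 1) of (r, l) \<Rightarrow> sg2 (r + 1) (l - 1) * K r l)
        = x * q powi n * (case p of (r, l) \<Rightarrow> sg2 r l * K r l)"
      using kernel_shift[of n r l] by (simp add: p K_def mult_ac)
  qed auto
  finally have shifted: "((\<lambda>(r, l). sg2 (r + 1) (l - 1) * K r l) has_sum x * q powi n * D) UNIV" .
  have row: "((\<lambda>(r, l). if l = 0 then K r l else 0) has_sum jtheta x q) UNIV"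
  proof (rule has_sum_row)
    have b: "binom2 (1 - k) = binom2 k" for k
      using binom2_plus1[of "- k"] binom2_minus[of k] by (simp add: algebra_simps)
    have "((\<lambda>k. (-1) powi k * x powi k * q powi binom2 k) has_sum jtheta x q) UNIV"
      using theta_summable[OF q x] jacobi_triple_product[OF q x] by (simp add: has_sum_iff)
    also have "?this \<longleftrightarrow> ((\<lambda>r. K r 0) has_sum jtheta x q) UNIV"
      by (rule has_sum_reindex_bij_witness[of _ uminus uminus])
        (auto simp: K_def kernel_def binom2_def[of 1] b intro!: minus1_powi_cong)
    finally show "((\<lambda>r. K r 0) has_sum jtheta x q) UNIV" .
  qed
  have column: "((\<lambda>(r, l). if r = -1 then K r l else 0) has_sum 0) UNIV"
  proof (rule has_sum_column)
    have "((\<lambda>l. - x * ((-1) powi l * q powi (binom2 l + n * l))) has_sum (- x * 0)) UNIV"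
      by (intro has_sum_cmult_right theta_at_power_has_sum q)
    also have "(\<lambda>l. - x * ((-1) powi l * q powi (binom2 l + n * l))) = (\<lambda>l. K (-1) l)"
    proof
      fix l
      have e: "binom2 (- 1 + 1) + binom2 (l + 1) + (- 1) * l = binom2 l"
        by (simp add: binom2_plus1 binom2_def[of 0])
      show "- x * ((-1) powi l * q powi (binom2 l + n * l)) = K (-1) l"
        unfolding K_def kernel_def e using q0 by (simp add: power_int_add power_int_diff)
    qed
    finally show "((\<lambda>l. K (-1) l) has_sum 0) UNIV"
      by simp
  qed
  have "((\<lambda>p. (case p of (r, l) \<Rightarrow> sg2 (r + 1) (l - 1) * K r l)
             + (case p of (r, l) \<Rightarrow> if l = 0 then K r l else 0)
             + - (case p of (r, l) \<Rightarrow> if r = -1 then K r l else 0)) has_sum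
          x * q powi n * D + jtheta x q + - 0) UNIV"
    by (intro has_sum_add has_sum_uminusI shifted row column)
  also have "(\<lambda>p. (case p of (r, l) \<Rightarrow> sg2 (r + 1) (l - 1) * K r l)
             + (case p of (r, l) \<Rightarrow> if l = 0 then K r l else 0)
             + - (case p of (r, l) \<Rightarrow> if r = -1 then K r l else 0)) = (\<lambda>(r, l). sg2 r l * K r l)"
    by (auto simp: sg2_eq fun_eq_iff)
  finally have "D = x * q powi n * D + jtheta x q + - 0"
    by (rule has_sum_unique[OF D])
  then have "jtheta x q = D * (1 - x * q powi n)"
    by algebra
  then show ?thesis
    using nz by (simp add: D_def K_def)
qed

end

section \<open>The weights of the double sum and their growth\<close>

definition parity_pairs :: "(int \<times> int) set" where
  "parity_pairs = {(r, s). r mod 2 = s mod 2}"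

definition g_weight :: "int \<Rightarrow> int \<Rightarrow> complex \<Rightarrow> int \<times> int \<Rightarrow> complex" where
  "g_weight t m q = (\<lambda>(r, s). sg2 r s * ((-1) powi ((r - s) div 2) * q powi g_exp t m r s))"

text \<open>
  In the coordinates \<open>r = n + j\<close>, \<open>s = n - j\<close> on the pairs of equal parity this is \<open>n\<close>, the exponent of
  the linear factor in \<open>g_sum\<close>.
\<close>
definition half_sum :: "int \<times> int \<Rightarrow> int" where
  "half_sum = (\<lambda>(r, s). (r + s) div 2)"

text \<open>
  The coefficient that arises when \<open>1 / (1 - x * q powi n)\<close> in \<open>g_sum\<close> is replaced by
  \<open>q powi (l * n)\<close>.
\<close>
definition moment :: "int \<Rightarrow> int \<Rightarrow> complex \<Rightarrow> int \<Rightarrow> complex" where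
  "moment t m q l = (\<Sum>\<^sub>\<infinity>p\<in>parity_pairs. g_weight t m q p * q powi (l * half_sum p))"

lemma parity_pairsE:
  assumes "p \<in> parity_pairs"
  obtains n j where "p = (n + j, n - j)"
proof -
  obtain r s where p: "p = (r, s)" "r mod 2 = s mod 2"
    using assms by (auto simp: parity_pairs_def)
  have "r = (r + s) div 2 + (r - s) div 2" "s = (r + s) div 2 - (r - s) div 2"
    using p(2) by presburger+
  with p that show ?thesis
    by metis
qed

lemma eight_g_exp:
  assumes "r mod 2 = s mod 2"
  shows "8 * g_exp t m r s
    = r^2 + 2 * (4*t - 1) * r * s + s^2 + 2 * (4*t - 1 - 2*m) * r + 2 * (1 + 2*m) * s"
proof -
  have "real_of_int (8 * g_exp t m r s)
    = real_of_int (r^2 + 2 * (4*t - 1) * r * s + s^2 + 2 * (4*t - 1 - 2*m) * r + 2 * (1 + 2*m) * s)"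
    using g_exp_exact[OF assms, of t m] by (simp add: field_simps)
  then show ?thesis
    by (simp only: of_int_eq_iff)
qed

text \<open>
  The substitution diagonalises the quadratic form. It is positive in \<open>n\<close> and negative in \<open>j\<close>,
  which is why the sum is restricted to the cone \<open>\<bar>j\<bar> \<le> \<bar>n\<bar>\<close> by \<open>sg2\<close>.
\<close>
lemma g_exp_diagonal:
  "g_exp t m (n + j) (n - j) = t * n * (n + 1) - (2 * t - 1) * binom2 j - m * j"
proof -
  have "(n + j) mod 2 = (n - j) mod 2"
    by presburger
  note eight_g_exp[OF this, of t m]
  moreover have "8 * ((2 * t - 1) * binom2 j) = 4 * (2 * t - 1) * (j * (j - 1))"
  proof -
    have "8 * ((2 * t - 1) * binom2 j) = 4 * (2 * ((2 * t - 1) * binom2 j))"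
      by simp
    then show ?thesis
      unfolding two_times_binom2 by (simp only: mult.assoc)
  qed
  ultimately show ?thesis
    by (simp add: algebra_simps power2_eq_square)
qed

text \<open>
  On the cone the negative part is controlled by the factorisation
  \<open>N * (N + 1) - j * (j - 1) = (N + j) * (N - j + 1)\<close>; what remains of the quadratic part of twice
  the exponent is \<open>N * (N + 1)\<close>. The linear surplus \<open>2 * N\<close> comes from \<open>m \<ge> 1\<close>, and
  \<open>m < t\<close> enters through \<open>2 * m \<le> 2 * t - 1\<close>.
\<close>
lemma g_exp_lower_bound:
  assumes "1 \<le> m" "m < t" "\<bar>j\<bar> \<le> N"
  shows "N * (N + 1) + 2 * N \<le> 2 * (t * N * (N + 1) - (2 * t - 1) * binom2 j - m * j)"
proof -
  have "2 * m * (N + j) \<le> (2 * t - 1) * (N + j)"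
    using assms by (intro mult_right_mono) auto
  also have "\<dots> = (2 * t - 1) * (N + j) * 1"
    by simp
  also have "\<dots> \<le> (2 * t - 1) * (N + j) * (N - j + 1)"
    using assms by (intro mult_left_mono mult_nonneg_nonneg) auto
  also have "\<dots> = (2 * t - 1) * (N * (N + 1)) - 2 * ((2 * t - 1) * binom2 j)"
    unfolding two_times_binom2 by (simp add: algebra_simps)
  finally have "2 * m * (N + j) \<le> (2 * t - 1) * (N * (N + 1)) - 2 * ((2 * t - 1) * binom2 j)" .
  moreover have "1 * N \<le> m * N"
    using assms by (intro mult_right_mono) auto
  ultimately show ?thesis
    by (simp add: algebra_simps)
qed

text \<open>
  The exponent of a weight times \<open>q powi (l * n)\<close>, together with the part of the exponent of
  \<open>kernel\<close> that depends on \<open>l\<close>: the term \<open>max 0 (- l)\<close> is the least value of \<open>r * l\<close> for indices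
  of equal sign. When \<open>n\<close> and \<open>l\<close> have opposite signs, the quadratic part of the bound is only half the
  square of \<open>n + l\<close>, which does not grow along \<open>l = - n\<close>; there the bound rests on the linear surplus
  from \<open>g_exp_lower_bound\<close>. With \<open>N\<close> equal to \<open>n\<close> or \<open>- n - 1\<close>, both halves of the cone become
  \<open>\<bar>j\<bar> \<le> N\<close>. The factor \<open>4\<close> clears denominators.
\<close>
lemma total_exponent_lower_bound:
  assumes "1 \<le> m" "m < t" "r mod 2 = s mod 2" "sg2 r s \<noteq> 0"
  shows "2 * \<bar>l\<bar> + \<bar>r\<bar> + \<bar>s\<bar> - 6
    \<le> 4 * (g_exp t m r s + l * half_sum (r, s) + (binom2 (l + 1) + max 0 (- l)))"
proof -
  have "(r, s) \<in> parity_pairs"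
    using assms(3) by (simp add: parity_pairs_def)
  then obtain n j where "(r, s) = (n + j, n - j)"
    by (rule parity_pairsE)
  then have rs: "r = n + j" "s = n - j"
    by simp_all
  have h: "half_sum (r, s) = n"
    by (simp add: half_sum_def rs)
  define N where "N = (if n \<ge> 0 then n else - n - 1)"
  have N: "\<bar>j\<bar> \<le> N" "\<bar>r\<bar> + \<bar>s\<bar> \<le> 2 * N + 2"
    using assms(4) by (auto simp: N_def rs sg2_eq split: if_splits)
  have tn: "t * n * (n + 1) = t * N * (N + 1)"
    by (simp add: N_def algebra_simps)
  have G: "N * (N + 1) + 2 * N \<le> 2 * g_exp t m r s"
    using g_exp_lower_bound[OF assms(1,2) N(1)] unfolding rs g_exp_diagonal tn by simp
  have B: "2 * binom2 (l + 1) = l * (l + 1)"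
    using two_binom2[of "l + 1"] by (simp add: algebra_simps)
  have "\<bar>l\<bar> + N - 2 \<le> N * (N + 1) + 2 * N + 2 * (l * n) + l * (l + 1) + 2 * max 0 (- l)"
  proof (cases "n \<ge> 0"; cases "l \<ge> 0")
    assume "n \<ge> 0" "l \<ge> 0"
    then have "N = n" "0 \<le> l * n" "0 \<le> N * N" "0 \<le> l * l" "0 \<le> N"
      by (auto simp: N_def)
    then show ?thesis
      using \<open>l \<ge> 0\<close> by (simp add: algebra_simps)
  next
    assume "n \<ge> 0" "\<not> l \<ge> 0"
    then have "N = n" "0 \<le> (N + l) * (N + l)" "0 \<le> N"
      by (auto simp: N_def)
    then show ?thesis
      using \<open>\<not> l \<ge> 0\<close> by (simp add: algebra_simps)
  next
    assume "\<not> n \<ge> 0" "l \<ge> 0"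
    then have "l * n = - (l * N) - l" "0 \<le> N"
      by (auto simp: N_def algebra_simps)
    moreover have "0 \<le> (l - N - 1) * (l - N - 1)"
      by simp
    ultimately show ?thesis
      using \<open>l \<ge> 0\<close> by (simp add: algebra_simps)
  next
    assume "\<not> n \<ge> 0" "\<not> l \<ge> 0"
    then have n: "n = - N - 1" and "0 \<le> N * (- l)" "0 \<le> N * N" "0 \<le> l * l" "0 \<le> N"
      by (auto simp: N_def simp del: mult_minus_right intro!: mult_nonneg_nonneg)
    moreover have "l * n = - (l * N) - l"
      by (simp add: n algebra_simps)
    ultimately show ?thesis
      using \<open>\<not> l \<ge> 0\<close> by (simp add: algebra_simps)
  qed
  with B have "\<bar>l\<bar> + N - 2 \<le> N * (N + 1) + 2 * N + 2 * (l * n + (binom2 (l + 1) + max 0 (- l)))"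
    by (simp only: distrib_left)
  with G have "\<bar>l\<bar> + N - 2 \<le> 2 * (g_exp t m r s + l * n + (binom2 (l + 1) + max 0 (- l)))"
    by simp
  with N(2) show ?thesis
    unfolding h by simp
qed

locale theta_params =
  fixes q :: complex and t m :: int
  assumes q: "0 < norm q" "norm q < 1" and t: "1 \<le> m" "m < t"
begin

lemma q0: "q \<noteq> 0"
  using q by auto

text \<open>
  A fourth root of \<open>norm q\<close>, so that the bound of \<open>total_exponent_lower_bound\<close> turns into a product of
  geometric terms.
\<close>
definition \<rho> :: real where "\<rho> = norm q powr (1 / 4)"

lemma \<rho>: "0 < \<rho>" "\<rho> < 1" "norm q powi e = \<rho> powi (4 * e)"
proof -
  show "0 < \<rho>" "\<rho> < 1"
    using q powr_less_mono2[of "1 / 4" "norm q" 1] by (auto simp: \<rho>_def)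
  have "norm q = \<rho> powi 4"
    using q by (simp add: \<rho>_def powr_powr flip: powr_numeral)
  then show "norm q powi e = \<rho> powi (4 * e)"
    by (simp only: power_int_mult)
qed

definition majorant :: "int \<times> int \<Rightarrow> real" where
  "majorant = (\<lambda>(r, s). \<rho> ^ nat \<bar>r\<bar> * \<rho> ^ nat \<bar>s\<bar>)"

lemma majorant_summable: "majorant summable_on A"
proof -
  have "majorant summable_on UNIV"
    using summable_on_product[OF geometric_summable_int[of \<rho>] geometric_summable_int[of \<rho>]] \<rho>
    by (simp add: majorant_def)
  then show ?thesis
    by (rule summable_on_subset_banach) simp
qed

lemma norm_weight_le:
  assumes "p \<in> parity_pairs"
  shows "norm q powi (binom2 (l + 1) + max 0 (- l)) * norm (g_weight t m q p * q powi (l * half_sum p))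
    \<le> \<rho> powi (- 6) * (\<rho> ^ nat \<bar>l\<bar> * majorant p)"
proof -
  obtain r s where p: "p = (r, s)" "r mod 2 = s mod 2"
    using assms by (auto simp: parity_pairs_def)
  show ?thesis
  proof (cases "sg2 r s = 0")
    case True
    then show ?thesis
      using \<rho> by (simp add: p g_weight_def majorant_def)
  next
    case False
    then have s: "norm (sg2 r s) = 1"
      by (auto simp: sg2_eq split: if_splits)
    define E where "E = g_exp t m r s + l * half_sum (r, s) + (binom2 (l + 1) + max 0 (- l))"
    have "2 * \<bar>l\<bar> + \<bar>r\<bar> + \<bar>s\<bar> - 6 \<le> 4 * E"
      unfolding E_def by (rule total_exponent_lower_bound) (use t p False in auto)
    then have E: "\<bar>l\<bar> + \<bar>r\<bar> + \<bar>s\<bar> + (- 6) \<le> 4 * E"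
      by simp
    have "norm q powi (binom2 (l + 1) + max 0 (- l)) * norm (g_weight t m q p * q powi (l * half_sum p))
        = norm q powi E"
      using q by (simp add: p g_weight_def norm_mult norm_power_int s E_def power_int_add)
    also have "\<dots> = \<rho> powi (4 * E)"
      by (rule \<rho>)
    also have "\<dots> \<le> \<rho> powi (\<bar>l\<bar> + \<bar>r\<bar> + \<bar>s\<bar> + (- 6))"
      using \<rho> E by (intro power_int_decreasing) auto
    also have "\<dots> = \<rho> powi \<bar>l\<bar> * \<rho> powi \<bar>r\<bar> * \<rho> powi \<bar>s\<bar> * \<rho> powi (- 6)"
      using \<rho>(1) by (simp only: powi_add)
    also have "\<dots> = \<rho> powi (- 6) * (\<rho> ^ nat \<bar>l\<bar> * majorant p)"
      by (simp add: p majorant_def power_int_nonneg_exp)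
    finally show ?thesis .
  qed
qed

lemma weight_abs_summable:
  "(\<lambda>p. norm (g_weight t m q p * q powi (l * half_sum p))) summable_on parity_pairs"
proof (rule Infinite_Sum.abs_summable_on_comparison_test')
  let ?c = "norm q powi (binom2 (l + 1) + max 0 (- l))"
  have c: "?c > 0"
    using q by simp
  show "(\<lambda>p. \<rho> powi (- 6) * \<rho> ^ nat \<bar>l\<bar> / ?c * majorant p) summable_on parity_pairs"
    by (intro summable_on_cmult_right majorant_summable)
  show "norm (g_weight t m q p * q powi (l * half_sum p)) \<le> \<rho> powi (- 6) * \<rho> ^ nat \<bar>l\<bar> / ?c * majorant p"
    if "p \<in> parity_pairs" for p
    using norm_weight_le[OF that, of l] c by (simp add: field_simps)
qed

lemma weight_summable: "(\<lambda>p. g_weight t m q p * q powi (l * half_sum p)) summable_on parity_pairs"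
  by (rule abs_summable_summable[OF weight_abs_summable])

definition kernel_majorant :: "real \<Rightarrow> real \<Rightarrow> int \<times> int \<Rightarrow> real" where
  "kernel_majorant X C = (\<lambda>(r, l). (X powi (- r) * norm q powi binom2 (r + 1)) * (C * \<rho> ^ nat \<bar>l\<bar>))"

lemma kernel_majorant_summable:
  assumes "0 < X" "0 \<le> C"
  shows "kernel_majorant X C summable_on UNIV"
proof -
  have "(\<lambda>r. X powi (- r) * norm q powi binom2 (r + 1)) summable_on UNIV"
    using kernel_row_summable[OF q, of "of_real X"] assms by simp
  then show ?thesis
    using summable_on_product[of "\<lambda>r. X powi (- r) * norm q powi binom2 (r + 1)" UNIV
        "\<lambda>l. C * \<rho> ^ nat \<bar>l\<bar>" UNIV] assms \<rho>
    by (simp add: kernel_majorant_def summable_on_cmult_right geometric_summable_int)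
qed

text \<open>
  A term of the expansion of the theta quotient, with \<open>q powi (n * l)\<close> replaced by any coefficient \<open>a\<close> that
  satisfies the growth condition on \<open>l\<close>. This covers a single weight as well as a moment.
\<close>
lemma norm_kernel_le:
  assumes a: "norm q powi (binom2 (l + 1) + max 0 (- l)) * norm a \<le> C * \<rho> ^ nat \<bar>l\<bar>" and x: "x \<noteq> 0"
  shows "norm (sg2 r l * kernel x q r l * a) \<le> kernel_majorant (norm x) C (r, l)"
proof (cases "sg2 r l = 0")
  case True
  have "0 \<le> norm q powi (binom2 (l + 1) + max 0 (- l)) * norm a"
    using q by simp
  also note a
  finally show ?thesis
    using True by (simp add: kernel_majorant_def)
next
  case False
  then have s: "norm (sg2 r l) = 1" and rl: "max 0 (- l) \<le> r * l"
  proof -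
    show "norm (sg2 r l) = 1"
      using False by (auto simp: sg2_eq split: if_splits)
    consider "0 \<le> r" "0 \<le> l" | "r \<le> - 1" "l < 0"
      using False by (force simp: sg2_eq split: if_splits)
    then show "max 0 (- l) \<le> r * l"
    proof cases
      case 2
      then have "(- 1) * l \<le> r * l"
        by (intro mult_right_mono_neg) auto
      then show ?thesis
        using 2 by simp
    qed simp
  qed
  have "norm (sg2 r l * kernel x q r l * a)
      = norm x powi (- r) * norm q powi binom2 (r + 1) * (norm q powi (binom2 (l + 1) + r * l) * norm a)"
    using q by (simp add: kernel_def norm_mult norm_power_int s power_int_add)
  also have "\<dots> \<le> norm x powi (- r) * norm q powi binom2 (r + 1)
      * (norm q powi (binom2 (l + 1) + max 0 (- l)) * norm a)"
    using q rl by (intro mult_left_mono mult_right_mono power_int_decreasing) auto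
  also have "\<dots> \<le> norm x powi (- r) * norm q powi binom2 (r + 1) * (C * \<rho> ^ nat \<bar>l\<bar>)"
    by (intro mult_left_mono a) auto
  finally show ?thesis
    by (simp add: kernel_majorant_def)
qed

definition moment_bound :: real where
  "moment_bound = \<rho> powi (- 6) * infsum majorant parity_pairs"

lemma moment_bound_nonneg: "0 \<le> moment_bound"
  using \<rho> by (auto simp: moment_bound_def majorant_def intro!: mult_nonneg_nonneg infsum_nonneg)

lemma norm_moment_le:
  "norm q powi (binom2 (l + 1) + max 0 (- l)) * norm (moment t m q l) \<le> moment_bound * \<rho> ^ nat \<bar>l\<bar>"
proof -
  let ?c = "norm q powi (binom2 (l + 1) + max 0 (- l))"
  have "?c * norm (moment t m q l)
      \<le> ?c * (\<Sum>\<^sub>\<infinity>p\<in>parity_pairs. norm (g_weight t m q p * q powi (l * half_sum p)))"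
    unfolding moment_def by (intro mult_left_mono norm_infsum_bound weight_abs_summable) auto
  also have "\<dots> = (\<Sum>\<^sub>\<infinity>p\<in>parity_pairs. ?c * norm (g_weight t m q p * q powi (l * half_sum p)))"
    by (rule infsum_cmult_right'[symmetric])
  also have "\<dots> \<le> (\<Sum>\<^sub>\<infinity>p\<in>parity_pairs. \<rho> powi (- 6) * (\<rho> ^ nat \<bar>l\<bar> * majorant p))"
    by (intro infsum_mono summable_on_cmult_right weight_abs_summable majorant_summable norm_weight_le)
  also have "\<dots> = moment_bound * \<rho> ^ nat \<bar>l\<bar>"
    by (simp add: infsum_cmult_right' moment_bound_def)
  finally show ?thesis .
qed

text \<open>
  The common value of the two sides of the identity to be proved, defined for every nonzero \<open>x\<close>.
\<close>
definition kernel_sum :: "complex \<Rightarrow> complex" where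
  "kernel_sum x = (\<Sum>\<^sub>\<infinity>(r, l). sg2 r l * kernel x q r l * moment t m q l)"

lemma kernel_sum_summable:
  assumes "x \<noteq> 0"
  shows "(\<lambda>(r, l). sg2 r l * kernel x q r l * moment t m q l) summable_on UNIV"
proof (rule abs_summable_summable, rule Infinite_Sum.abs_summable_on_comparison_test')
  show "kernel_majorant (norm x) moment_bound summable_on UNIV"
    using assms moment_bound_nonneg by (intro kernel_majorant_summable) auto
  show "norm (case p of (r, l) \<Rightarrow> sg2 r l * kernel x q r l * moment t m q l)
      \<le> kernel_majorant (norm x) moment_bound p" for p
    using norm_kernel_le[OF norm_moment_le assms] by (auto split: prod.split)
qed

text \<open>
  Expand each quotient \<open>jtheta x q / (1 - x * q powi n)\<close> and interchange the two double sums; the inner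
  sum is then a moment.
\<close>
lemma theta_times_g_sum:
  assumes x: "x \<noteq> 0" and nz: "\<And>n. 1 - x * q powi n \<noteq> 0"
  shows "jtheta x q * g_sum t m q x = kernel_sum x"
proof -
  define F where "F = (\<lambda>p (r, l). sg2 r l * kernel x q r l * (g_weight t m q p * q powi (l * half_sum p)))"
  have F_summable: "(\<lambda>(p, p'). F p p') summable_on parity_pairs \<times> UNIV"
  proof (rule abs_summable_summable, rule Infinite_Sum.abs_summable_on_comparison_test')
    have "kernel_majorant (norm x) (\<rho> powi (- 6)) summable_on UNIV"
      using x \<rho> by (intro kernel_majorant_summable) auto
    then show "(\<lambda>(p, p'). majorant p * kernel_majorant (norm x) (\<rho> powi (- 6)) p')
        summable_on parity_pairs \<times> UNIV"
      using \<rho> by (intro summable_on_product majorant_summable)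
        (auto simp: majorant_def kernel_majorant_def intro!: mult_nonneg_nonneg)
    fix z assume "z \<in> parity_pairs \<times> (UNIV :: (int \<times> int) set)"
    then obtain p r l where z: "z = (p, (r, l))" "p \<in> parity_pairs"
      by auto
    have "norm q powi (binom2 (l + 1) + max 0 (- l)) * norm (g_weight t m q p * q powi (l * half_sum p))
        \<le> \<rho> powi (- 6) * majorant p * \<rho> ^ nat \<bar>l\<bar>"
      using norm_weight_le[OF z(2), of l] by (simp add: mult_ac)
    from norm_kernel_le[OF this x, of r]
    show "norm (case z of (p, p') \<Rightarrow> F p p')
        \<le> (case z of (p, p') \<Rightarrow> majorant p * kernel_majorant (norm x) (\<rho> powi (- 6)) p')"
      by (simp add: z F_def kernel_majorant_def mult_ac)
  qed
  have "g_sum t m q x = (\<Sum>\<^sub>\<infinity>p\<in>parity_pairs. g_weight t m q p / (1 - x * q powi half_sum p))"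
    unfolding g_sum_def parity_pairs_def
    by (intro infsum_cong) (auto simp: g_weight_def half_sum_def)
  then have "jtheta x q * g_sum t m q x
      = (\<Sum>\<^sub>\<infinity>p\<in>parity_pairs. jtheta x q * (g_weight t m q p / (1 - x * q powi half_sum p)))"
    by (simp only: infsum_cmult_right')
  also have "\<dots> = (\<Sum>\<^sub>\<infinity>p\<in>parity_pairs. \<Sum>\<^sub>\<infinity>p'. F p p')"
  proof (rule infsum_cong)
    fix p
    have "jtheta x q * (g_weight t m q p / (1 - x * q powi half_sum p))
        = g_weight t m q p * (jtheta x q / (1 - x * q powi half_sum p))"
      by simp
    also have "\<dots> = (\<Sum>\<^sub>\<infinity>p'. g_weight t m q p *
        (case p' of (r, l) \<Rightarrow> sg2 r l * (kernel x q r l * q powi (half_sum p * l))))"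
      unfolding theta_quotient_expansion[OF q x nz] by (rule infsum_cmult_right'[symmetric])
    also have "\<dots> = (\<Sum>\<^sub>\<infinity>p'. F p p')"
      by (intro infsum_cong) (auto simp: F_def mult_ac)
    finally show "jtheta x q * (g_weight t m q p / (1 - x * q powi half_sum p)) = (\<Sum>\<^sub>\<infinity>p'. F p p')" .
  qed
  also have "\<dots> = (\<Sum>\<^sub>\<infinity>p'. \<Sum>\<^sub>\<infinity>p\<in>parity_pairs. F p p')"
    by (rule infsum_swap_banach[OF F_summable])
  also have "\<dots> = kernel_sum x"
    unfolding kernel_sum_def F_def moment_def
    by (intro infsum_cong) (auto simp: infsum_cmult_right')
  finally show ?thesis .
qed

section \<open>Quasi-periodicity of the moments\<close>

text \<open>
  The boundary terms that appear when the cone is moved by one unit in the direction of \<open>n\<close>. On each of the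
  two lines \<open>r = 0\<close> and \<open>s = 0\<close> the exponent reduces to \<open>binom2 k\<close> plus an integer multiple of
  \<open>k\<close>, so both sums are theta functions at integer powers of \<open>q\<close>.
\<close>
lemma boundary_row:
  "((\<lambda>(r, s). if r = 0 then (-1) powi ((r - s) div 2) * q powi (g_exp t m r s + l * half_sum (r, s)) else 0)
     has_sum 0) parity_pairs"
proof -
  define f where "f = (\<lambda>(r, s). (-1) powi ((r - s) div 2) * q powi (g_exp t m r s + l * half_sum (r, s)))"
  have "f (0, 2 * k) = (-1) powi k * q powi (binom2 k + (1 + m + l) * k)" for k
  proof -
    have "2 * g_exp t m (k + (- k)) (k - (- k)) = 2 * (binom2 k + (1 + m) * k)"
      unfolding g_exp_diagonal binom2_minus
      using two_times_binom2[of t k] two_binom2[of k] by (simp add: algebra_simps)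
    then have g: "g_exp t m 0 (2 * k) = binom2 k + (1 + m) * k"
      by simp
    have e: "g_exp t m 0 (2 * k) + l * half_sum (0, 2 * k) = binom2 k + (1 + m + l) * k"
      unfolding g half_sum_def by (simp add: algebra_simps)
    have d: "(0 - 2 * k) div 2 = - k"
      by simp
    have "(-1 :: complex) powi (- k) = (-1) powi k"
      by (rule minus1_powi_cong) simp
    then show ?thesis
      unfolding f_def prod.case e d by simp
  qed
  then have "((\<lambda>k. f (0, 2 * k)) has_sum 0) UNIV"
    using theta_at_power_has_sum[OF q, of "1 + m + l"] by simp
  then have "(f has_sum 0) (range (\<lambda>k. (0, 2 * k)))"
    by (subst has_sum_reindex) (auto simp: inj_def o_def)
  moreover have "range (\<lambda>k. (0, 2 * k)) = {p \<in> parity_pairs. fst p = 0}"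
  proof -
    have "0 mod 2 = a mod 2 \<Longrightarrow> \<exists>k. a = 2 * k" for a :: int
      by presburger
    then show ?thesis
      by (auto simp: parity_pairs_def image_iff)
  qed
  ultimately have "(f has_sum 0) {p \<in> parity_pairs. fst p = 0}"
    by simp
  then show ?thesis
    by (rule has_sum_cong_neutral[THEN iffD1, rotated -1]) (auto simp: f_def)
qed

lemma boundary_column:
  "((\<lambda>(r, s). if s = 0 then (-1) powi ((r - s) div 2) * q powi (g_exp t m r s + l * half_sum (r, s)) else 0)
     has_sum 0) parity_pairs"
proof -
  define f where "f = (\<lambda>(r, s). (-1) powi ((r - s) div 2) * q powi (g_exp t m r s + l * half_sum (r, s)))"
  have "f (2 * k, 0) = (-1) powi k * q powi (binom2 k + (2 * t - m + l) * k)" for k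
  proof -
    have "2 * g_exp t m (k + k) (k - k) = 2 * (binom2 k + (2 * t - m) * k)"
      unfolding g_exp_diagonal
      using two_times_binom2[of t k] two_binom2[of k] by (simp add: algebra_simps)
    then have g: "g_exp t m (2 * k) 0 = binom2 k + (2 * t - m) * k"
      by simp
    have e: "g_exp t m (2 * k) 0 + l * half_sum (2 * k, 0) = binom2 k + (2 * t - m + l) * k"
      unfolding g half_sum_def by (simp add: algebra_simps)
    have d: "(2 * k - 0) div 2 = k"
      by simp
    show ?thesis
      unfolding f_def prod.case e d by simp
  qed
  then have "((\<lambda>k. f (2 * k, 0)) has_sum 0) UNIV"
    using theta_at_power_has_sum[OF q, of "2 * t - m + l"] by simp
  then have "(f has_sum 0) (range (\<lambda>k. (2 * k, 0)))"
    by (subst has_sum_reindex) (auto simp: inj_def o_def)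
  moreover have "range (\<lambda>k. (2 * k, 0)) = {p \<in> parity_pairs. snd p = 0}"
  proof -
    have "0 mod 2 = a mod 2 \<Longrightarrow> \<exists>k. a = 2 * k" for a :: int
      by presburger
    then show ?thesis
      by (auto simp: parity_pairs_def image_iff)
  qed
  ultimately have "(f has_sum 0) {p \<in> parity_pairs. snd p = 0}"
    by simp
  then show ?thesis
    by (rule has_sum_cong_neutral[THEN iffD1, rotated -1]) (auto simp: f_def)
qed

text \<open>
  Raising \<open>l\<close> by \<open>2 * t\<close> amounts, up to a constant power of \<open>q\<close>, to replacing \<open>n\<close> by \<open>n + 1\<close>: the
  exponent contains \<open>t * n * (n + 1)\<close>, which then grows by \<open>2 * t * n + 2 * t\<close>. The shift moves the cone on which \<open>sg2\<close> is supported, but the difference is a sum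
  over the two boundary lines, and it vanishes.
\<close>
lemma moment_shift: "moment t m q (l + 2 * t) = q powi (- 2 * t - l) * moment t m q l"
proof -
  define V where "V = (\<lambda>r s. (-1) powi ((r - s) div 2) * q powi (g_exp t m r s + l * half_sum (r, s)))"
  have gw: "g_weight t m q (r, s) * q powi (a * half_sum (r, s))
      = sg2 r s * ((-1) powi ((r - s) div 2) * q powi (g_exp t m r s + a * half_sum (r, s)))" for r s a
    using q0 by (simp add: g_weight_def powi_add)
  have all: "((\<lambda>(r, s). sg2 r s * V r s) has_sum moment t m q l) parity_pairs"
    unfolding moment_def
    by (rule has_sum_cong[THEN iffD1, OF _ has_sum_infsum[OF weight_summable]])
      (auto simp: gw V_def)
  have "((\<lambda>p. q powi (2 * t + l) * (g_weight t m q p * q powi ((l + 2 * t) * half_sum p)))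
      has_sum q powi (2 * t + l) * moment t m q (l + 2 * t)) parity_pairs"
    unfolding moment_def by (intro has_sum_cmult_right has_sum_infsum weight_summable)
  also have "?this \<longleftrightarrow> ((\<lambda>(r, s). sg2 (r - 1) (s - 1) * V r s)
      has_sum q powi (2 * t + l) * moment t m q (l + 2 * t)) parity_pairs"
  proof (rule has_sum_reindex_bij_witness
      [of _ "\<lambda>(r, s). (r - 1, s - 1)" "\<lambda>(r, s). (r + 1, s + 1)"])
    fix p assume "p \<in> parity_pairs"
    then obtain n j where p: "p = (n + j, n - j)"
      by (rule parity_pairsE)
    define r s where "r = n + j" and "s = n - j"
    have h: "half_sum (r, s) = n" "half_sum (r + 1, s + 1) = n + 1"
      by (simp_all add: half_sum_def r_def s_def)
    have "r + 1 = (n + 1) + j" "s + 1 = (n + 1) - j"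
      by (simp_all add: r_def s_def)
    then have e: "g_exp t m (r + 1) (s + 1) + l * (n + 1)
        = (2 * t + l) + (g_exp t m r s + (l + 2 * t) * n)"
      unfolding r_def s_def by (simp only: g_exp_diagonal) (simp add: algebra_simps)
    show "(case case p of (r, s) \<Rightarrow> (r + 1, s + 1) of (r, s) \<Rightarrow> sg2 (r - 1) (s - 1) * V r s)
        = q powi (2 * t + l) * (g_weight t m q p * q powi ((l + 2 * t) * half_sum p))"
      unfolding p r_def[symmetric] s_def[symmetric] gw unfolding prod.case V_def h e
      using q0 by (simp add: powi_add[of _ "2 * t + l"])
  qed (auto simp: parity_pairs_def mod_diff_cong mod_add_cong)
  finally have shifted: "((\<lambda>(r, s). sg2 (r - 1) (s - 1) * V r s)
      has_sum q powi (2 * t + l) * moment t m q (l + 2 * t)) parity_pairs" .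
  have "((\<lambda>p. (case p of (r, s) \<Rightarrow> sg2 (r - 1) (s - 1) * V r s)
            + (case p of (r, s) \<Rightarrow> if r = 0 then V r s else 0)
            + (case p of (r, s) \<Rightarrow> if s = 0 then V r s else 0))
      has_sum q powi (2 * t + l) * moment t m q (l + 2 * t) + 0 + 0) parity_pairs"
    unfolding V_def by (intro has_sum_add shifted[unfolded V_def] boundary_row boundary_column)
  also have "(\<lambda>p. (case p of (r, s) \<Rightarrow> sg2 (r - 1) (s - 1) * V r s)
            + (case p of (r, s) \<Rightarrow> if r = 0 then V r s else 0)
            + (case p of (r, s) \<Rightarrow> if s = 0 then V r s else 0)) = (\<lambda>(r, s). sg2 r s * V r s)"
    by (auto simp: sg2_eq fun_eq_iff)
  finally have "moment t m q l = q powi (2 * t + l) * moment t m q (l + 2 * t)"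
    using has_sum_unique[OF all] by simp
  moreover have "q powi (- 2 * t - l) * q powi (2 * t + l) = 1"
    using q0 powi_add[of q "- 2 * t - l" "2 * t + l"] by simp
  ultimately show ?thesis
    by (simp add: mult.assoc[symmetric])
qed

text \<open>
  The exponent accumulates the steps \<open>- 2 * t - (k + 2 * t * i)\<close> for \<open>i\<close> from \<open>0\<close> to
  \<open>s - 1\<close>, and the same quadratic polynomial serves for negative \<open>s\<close>.
\<close>
lemma moment_quasi_periodic:
  "moment t m q (k + 2 * t * s) = q powi (- (t * s * s + t * s + k * s)) * moment t m q k"
proof (induction s rule: int_induct[where k = 0])
  case base
  then show ?case
    by simp
next
  case (step1 s)
  have "moment t m q (k + 2 * t * (s + 1)) = q powi (- 2 * t - (k + 2 * t * s)) * moment t m q (k + 2 * t * s)"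
    using moment_shift[of "k + 2 * t * s"] by (simp add: algebra_simps)
  also have "\<dots> = q powi (- 2 * t - (k + 2 * t * s) + - (t * s * s + t * s + k * s)) * moment t m q k"
    unfolding step1.IH powi_add[OF q0, of "- 2 * t - (k + 2 * t * s)"] by (simp only: mult.assoc)
  also have "- 2 * t - (k + 2 * t * s) + - (t * s * s + t * s + k * s)
      = - (t * (s + 1) * (s + 1) + t * (s + 1) + k * (s + 1))"
    by (simp add: algebra_simps)
  finally show ?case .
next
  case (step2 s)
  have "moment t m q (k + 2 * t * s) = q powi (- (k + 2 * t * s)) * moment t m q (k + 2 * t * (s - 1))"
    using moment_shift[of "k + 2 * t * (s - 1)"] by (simp add: algebra_simps)
  moreover have "q powi (k + 2 * t * s) * q powi (- (k + 2 * t * s)) = 1"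
    using q0 powi_add[of q "k + 2 * t * s" "- (k + 2 * t * s)"] by simp
  ultimately have "moment t m q (k + 2 * t * (s - 1)) = q powi (k + 2 * t * s) * moment t m q (k + 2 * t * s)"
    by (simp add: mult.assoc[symmetric])
  also have "\<dots> = q powi (k + 2 * t * s + - (t * s * s + t * s + k * s)) * moment t m q k"
    unfolding step2.IH powi_add[OF q0, of "k + 2 * t * s"] by (simp only: mult.assoc)
  finally show ?case
    by (simp add: algebra_simps)
qed

section \<open>Hecke-type double sums\<close>

text \<open>
  Pairs \<open>(2 * r, 2 * s)\<close> give the first Hecke-type sum and pairs \<open>(2 * r + 1, 2 * s + 1)\<close> the second.
  Halving does not change the value of \<open>sg2\<close>, since \<open>2 * r + 1\<close> and \<open>r\<close> are nonnegative together.
\<close>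
lemma moment_eq_hecke:
  "moment t m q k = hecke_f 1 (4 * t - 1) 1 (q powi (2 * t + k - m)) (q powi (1 + m + k)) q
     + q powi (2 * t + k)
       * hecke_f 1 (4 * t - 1) 1 (q powi (4 * t + k - m)) (q powi (2 * t + m + k + 1)) q"
proof -
  define f where "f = (\<lambda>p. g_weight t m q p * q powi (k * half_sum p))"
  define ev od :: "int \<times> int \<Rightarrow> int \<times> int"
    where "ev = (\<lambda>(r, s). (2 * r, 2 * s))" and "od = (\<lambda>(r, s). (2 * r + 1, 2 * s + 1))"
  have inj: "inj ev" "inj od"
    by (auto simp: inj_def ev_def od_def)
  have split: "parity_pairs = range ev \<union> range od"
  proof (intro equalityI subsetI)
    fix p assume "p \<in> parity_pairs"
    then obtain r s where p: "p = (r, s)" "r mod 2 = s mod 2"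
      by (auto simp: parity_pairs_def)
    show "p \<in> range ev \<union> range od"
    proof (cases "even r")
      case True
      then have "p = ev (r div 2, s div 2)"
        using p by (auto simp: ev_def even_iff_mod_2_eq_zero)
      then show ?thesis
        by blast
    next
      case False
      then have "p = od (r div 2, s div 2)"
        using p by (auto simp: od_def) presburger+
      then show ?thesis
        by blast
    qed
  qed (auto simp: parity_pairs_def ev_def od_def)
  have summable: "f summable_on parity_pairs"
    unfolding f_def by (rule weight_summable)
  have "moment t m q k = infsum f (range ev \<union> range od)"
    by (simp add: moment_def f_def split)
  also have "\<dots> = infsum f (range ev) + infsum f (range od)"
  proof (rule infsum_Un_disjoint)
    show "range ev \<inter> range od = {}"
      by (auto simp: ev_def od_def) presburger
  qed (use summable split in \<open>auto intro: summable_on_subset_banach\<close>)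
  also have "infsum f (range ev) = hecke_f 1 (4 * t - 1) 1 (q powi (2 * t + k - m)) (q powi (1 + m + k)) q"
    unfolding infsum_reindex[OF inj(1)] hecke_f_def
  proof (rule infsum_cong)
    fix p :: "int \<times> int"
    obtain r s where p: "p = (r, s)"
      by force
    have "8 * (g_exp t m (2 * r) (2 * s) + k * (r + s))
        = 8 * ((2 * t + k - m) * r + (1 + m + k) * s + (1 * binom2 r + (4 * t - 1) * r * s + 1 * binom2 s))"
      using eight_g_exp[of "2 * r" "2 * s" t m] two_binom2[of r] two_binom2[of s]
      by (simp add: algebra_simps power2_eq_square)
    then have e: "g_exp t m (2 * r) (2 * s) + k * (r + s)
        = (2 * t + k - m) * r + (1 + m + k) * s + (1 * binom2 r + (4 * t - 1) * r * s + 1 * binom2 s)"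
      by simp
    have "(f \<circ> ev) p = sg2 (2 * r) (2 * s) * ((-1) powi (r - s) * q powi (g_exp t m (2 * r) (2 * s) + k * (r + s)))"
    proof -
      have "(2 * r - 2 * s) div 2 = r - s" "(2 * r + 2 * s) div 2 = r + s"
        by presburger+
      then show ?thesis
        using q0 by (simp add: p f_def ev_def g_weight_def half_sum_def powi_add)
    qed
    also have "\<dots> = sg2 r s * ((-1) powi (r + s) * q powi (g_exp t m (2 * r) (2 * s) + k * (r + s)))"
      using minus1_powi_cong[of "r - s" "r + s"] by (simp add: sg2_eq)
    also have "\<dots> = sg2 r s * (-1) powi (r + s) * (q powi (2 * t + k - m)) powi r * (q powi (1 + m + k)) powi s
        * q powi (1 * binom2 r + (4 * t - 1) * r * s + 1 * binom2 s)"
      unfolding e powi_add[OF q0, of "(2 * t + k - m) * r + (1 + m + k) * s"]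
        powi_add[OF q0, of "(2 * t + k - m) * r"] power_int_mult
      by (simp only: mult_ac)
    finally show "(f \<circ> ev) p = (case p of (r, s) \<Rightarrow> sg2 r s * (-1) powi (r + s) * (q powi (2 * t + k - m)) powi r
        * (q powi (1 + m + k)) powi s * q powi (1 * binom2 r + (4 * t - 1) * r * s + 1 * binom2 s))"
      by (simp add: p)
  qed
  also have "infsum f (range od)
      = q powi (2 * t + k) * hecke_f 1 (4 * t - 1) 1 (q powi (4 * t + k - m)) (q powi (2 * t + m + k + 1)) q"
    unfolding infsum_reindex[OF inj(2)] hecke_f_def infsum_cmult_right'[symmetric]
  proof (rule infsum_cong)
    fix p :: "int \<times> int"
    obtain r s where p: "p = (r, s)"
      by force
    have "(2 * r + 1) mod 2 = (2 * s + 1) mod 2"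
      by simp
    note g = eight_g_exp[OF this, of t m]
    have "8 * (g_exp t m (2 * r + 1) (2 * s + 1) + k * (r + s + 1))
        = 8 * (2 * t + k + ((4 * t + k - m) * r + (2 * t + m + k + 1) * s
            + (1 * binom2 r + (4 * t - 1) * r * s + 1 * binom2 s)))"
      using g two_binom2[of r] two_binom2[of s]
      by (simp add: algebra_simps power2_eq_square)
    then have e: "g_exp t m (2 * r + 1) (2 * s + 1) + k * (r + s + 1)
        = 2 * t + k + ((4 * t + k - m) * r + (2 * t + m + k + 1) * s
            + (1 * binom2 r + (4 * t - 1) * r * s + 1 * binom2 s))"
      by simp
    have "(f \<circ> od) p = sg2 (2 * r + 1) (2 * s + 1)
        * ((-1) powi (r - s) * q powi (g_exp t m (2 * r + 1) (2 * s + 1) + k * (r + s + 1)))"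
    proof -
      have "(2 * r + 1 - (2 * s + 1)) div 2 = r - s" "(2 * r + 1 + (2 * s + 1)) div 2 = r + s + 1"
        by presburger+
      then show ?thesis
        using q0 by (simp add: p f_def od_def g_weight_def half_sum_def powi_add add_ac)
    qed
    also have "\<dots> = sg2 r s
        * ((-1) powi (r + s) * q powi (g_exp t m (2 * r + 1) (2 * s + 1) + k * (r + s + 1)))"
      using minus1_powi_cong[of "r - s" "r + s"] by (auto simp: sg2_eq)
    also have "\<dots> = q powi (2 * t + k) * (sg2 r s * (-1) powi (r + s) * (q powi (4 * t + k - m)) powi r
        * (q powi (2 * t + m + k + 1)) powi s * q powi (1 * binom2 r + (4 * t - 1) * r * s + 1 * binom2 s))"
      unfolding e powi_add[OF q0, of "2 * t + k"] powi_add[OF q0, of "(4 * t + k - m) * r + (2 * t + m + k + 1) * s"]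
        powi_add[OF q0, of "(4 * t + k - m) * r"] power_int_mult
      by (simp only: mult_ac)
    finally show "(f \<circ> od) p = q powi (2 * t + k) * (case p of (r, s) \<Rightarrow> sg2 r s * (-1) powi (r + s)
        * (q powi (4 * t + k - m)) powi r * (q powi (2 * t + m + k + 1)) powi s
        * q powi (1 * binom2 r + (4 * t - 1) * r * s + 1 * binom2 s))"
      by (simp add: p)
  qed
  finally show ?thesis .
qed

text \<open>
  Within a residue class modulo \<open>2 * t\<close>, the quasi-periodicity turns the moment into a fixed factor times
  a power of \<open>q\<close>. The condition \<open>0 \<le> k < 2 * t\<close> ensures that \<open>k + 2 * t * s\<close> and \<open>s\<close> have
  the same sign.
\<close>
lemma residue_class_term:
  assumes x: "x \<noteq> 0" and k: "0 \<le> k" "k < 2 * t"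
  shows "(-1) powi k * q powi (binom2 k + k) * moment t m q k
      * hecke_f 1 (2 * t) (2 * t * (2 * t - 1)) (inverse x * q powi (k + 1)) (- (q powi ((k + t) * (2 * t - 1)))) q
    = (\<Sum>\<^sub>\<infinity>(r, s). sg2 r (k + 2 * t * s) * kernel x q r (k + 2 * t * s) * moment t m q (k + 2 * t * s))"
  unfolding hecke_f_def infsum_cmult_right'[symmetric]
proof (rule infsum_cong)
  fix p :: "int \<times> int"
  obtain r s where p: "p = (r, s)"
    by force
  define l where "l = k + 2 * t * s"
  have "l \<ge> 0 \<longleftrightarrow> s \<ge> 0"
  proof
    assume "l \<ge> 0"
    show "s \<ge> 0"
    proof (rule ccontr)
      assume "\<not> s \<ge> 0"
      then have "2 * t * s \<le> 2 * t * (- 1)"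
        using t by (intro mult_left_mono) auto
      with \<open>l \<ge> 0\<close> k show False
        by (simp add: l_def)
    qed
  next
    assume "s \<ge> 0"
    then show "l \<ge> 0"
      using t k by (simp add: l_def)
  qed
  then have s: "sg2 r l = sg2 r s"
    by (auto simp: sg2_eq)
  have "2 * (binom2 k + k + (k + 1) * r + (k + t) * (2 * t - 1) * s
        + (1 * binom2 r + 2 * t * r * s + 2 * t * (2 * t - 1) * binom2 s))
      = 2 * (binom2 (r + 1) + binom2 (l + 1) + r * l - (t * s * s + t * s + k * s))"
    using two_binom2[of k] two_binom2[of r] two_times_binom2[of "2 * t * (2 * t - 1)" s] two_binom2[of "l + 1"]
      binom2_plus1[of r]
    by (simp add: l_def algebra_simps)
  then have e: "(binom2 k + k) + ((k + 1) * r + ((k + t) * (2 * t - 1) * s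
        + (1 * binom2 r + 2 * t * r * s + 2 * t * (2 * t - 1) * binom2 s)))
      = (binom2 (r + 1) + binom2 (l + 1) + r * l) + (- (t * s * s + t * s + k * s))"
    by simp
  have "q powi (binom2 k + k) * ((q powi (k + 1)) powi r * ((q powi ((k + t) * (2 * t - 1))) powi s
        * q powi (1 * binom2 r + 2 * t * r * s + 2 * t * (2 * t - 1) * binom2 s)))
      = q powi ((binom2 k + k) + ((k + 1) * r + ((k + t) * (2 * t - 1) * s
        + (1 * binom2 r + 2 * t * r * s + 2 * t * (2 * t - 1) * binom2 s))))"
    unfolding powi_add[OF q0, of "binom2 k + k"] powi_add[OF q0, of "(k + 1) * r"]
      powi_add[OF q0, of "(k + t) * (2 * t - 1) * s"] power_int_mult ..
  also have "\<dots> = q powi (binom2 (r + 1) + binom2 (l + 1) + r * l) * q powi (- (t * s * s + t * s + k * s))"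
    unfolding e by (rule powi_add[OF q0])
  finally have E: "q powi (binom2 k + k) * ((q powi (k + 1)) powi r * ((q powi ((k + t) * (2 * t - 1))) powi s
        * q powi (1 * binom2 r + 2 * t * r * s + 2 * t * (2 * t - 1) * binom2 s)))
      = q powi (binom2 (r + 1) + binom2 (l + 1) + r * l) * q powi (- (t * s * s + t * s + k * s))" .
  have "(-1 :: complex) powi k * ((-1) powi (r + s) * (-1) powi s) = (-1) powi (k + (r + s + s))"
    by (simp add: powi_add)
  also have "\<dots> = (-1) powi (r + l)"
    by (rule minus1_powi_cong) (simp add: l_def)
  finally have S: "(-1 :: complex) powi k * ((-1) powi (r + s) * (-1) powi s) = (-1) powi (r + l)" .
  have X: "(inverse x * q powi (k + 1)) powi r = x powi (- r) * (q powi (k + 1)) powi r"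
    by (simp only: power_int_mult_distrib power_int_inverse power_int_minus)
  have Y: "(- (q powi ((k + t) * (2 * t - 1)))) powi s = (-1) powi s * (q powi ((k + t) * (2 * t - 1))) powi s"
    by (subst power_int_mult_distrib[symmetric]) simp
  have "(-1) powi k * q powi (binom2 k + k) * moment t m q k
        * (sg2 r s * (-1) powi (r + s) * (inverse x * q powi (k + 1)) powi r
            * (- (q powi ((k + t) * (2 * t - 1)))) powi s
            * q powi (1 * binom2 r + 2 * t * r * s + 2 * t * (2 * t - 1) * binom2 s))
      = sg2 r s * ((-1) powi k * ((-1) powi (r + s) * (-1) powi s)) * x powi (- r)
        * (q powi (binom2 k + k) * ((q powi (k + 1)) powi r * ((q powi ((k + t) * (2 * t - 1))) powi s
            * q powi (1 * binom2 r + 2 * t * r * s + 2 * t * (2 * t - 1) * binom2 s)))) * moment t m q k"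
    unfolding X Y by (simp only: mult_ac)
  also have "\<dots> = sg2 r l * kernel x q r l * moment t m q l"
    unfolding E S s kernel_def moment_quasi_periodic[of k s, folded l_def] by (simp only: mult_ac)
  finally show "(-1) powi k * q powi (binom2 k + k) * moment t m q k
        * (case p of (r, s) \<Rightarrow> sg2 r s * (-1) powi (r + s) * (inverse x * q powi (k + 1)) powi r
            * (- (q powi ((k + t) * (2 * t - 1)))) powi s
            * q powi (1 * binom2 r + 2 * t * r * s + 2 * t * (2 * t - 1) * binom2 s))
      = (case p of (r, s) \<Rightarrow>
          sg2 r (k + 2 * t * s) * kernel x q r (k + 2 * t * s) * moment t m q (k + 2 * t * s))"
    by (simp add: p l_def)
qed

lemma kernel_sum_eq_hecke:
  assumes x: "x \<noteq> 0"
  shows "kernel_sum x = (\<Sum>k = 0..2 * t - 1. (-1) powi k * q powi (binom2 k + k) * moment t m q k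
      * hecke_f 1 (2 * t) (2 * t * (2 * t - 1)) (inverse x * q powi (k + 1)) (- (q powi ((k + t) * (2 * t - 1)))) q)"
proof -
  define T where "T = (\<lambda>(r, l). sg2 r l * kernel x q r l * moment t m q l)"
  define h where "h = (\<lambda>(k, r :: int, s). (r, k + 2 * t * s))"
  have h: "bij_betw h ({0..2 * t - 1} \<times> UNIV) UNIV"
  proof (rule bij_betw_byWitness[where f' = "\<lambda>(r, l). (l mod (2 * t), r, l div (2 * t))"])
    show "(\<lambda>(r, l). (l mod (2 * t), r, l div (2 * t))) ` UNIV \<subseteq> {0..2 * t - 1} \<times> UNIV"
      using t by (auto simp: zle_diff1_eq)
  qed (use t in \<open>auto simp: h_def div_mult_self1\<close>)
  have "T summable_on UNIV"
    using kernel_sum_summable[OF x] by (simp add: T_def)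
  then have "(\<lambda>z. T (h z)) summable_on {0..2 * t - 1} \<times> UNIV"
    by (subst summable_on_reindex_bij_betw[OF h])
  then have summable: "(\<lambda>(k, p). T (h (k, p))) summable_on {0..2 * t - 1} \<times> UNIV"
    by (simp add: case_prod_beta')
  have "kernel_sum x = infsum T UNIV"
    by (simp add: kernel_sum_def T_def)
  also have "\<dots> = (\<Sum>\<^sub>\<infinity>z\<in>{0..2 * t - 1} \<times> UNIV. T (h z))"
    by (rule infsum_reindex_bij_betw[OF h, symmetric])
  also have "\<dots> = (\<Sum>\<^sub>\<infinity>k\<in>{0..2 * t - 1}. \<Sum>\<^sub>\<infinity>p. T (h (k, p)))"
    using infsum_Sigma'_banach[OF summable] by (simp add: case_prod_beta')
  also have "\<dots> = (\<Sum>k = 0..2 * t - 1. \<Sum>\<^sub>\<infinity>p. T (h (k, p)))"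
    by simp
  also have "\<dots> = (\<Sum>k = 0..2 * t - 1. (-1) powi k * q powi (binom2 k + k) * moment t m q k
      * hecke_f 1 (2 * t) (2 * t * (2 * t - 1)) (inverse x * q powi (k + 1)) (- (q powi ((k + t) * (2 * t - 1)))) q)"
  proof (rule sum.cong)
    fix k assume "k \<in> {0..2 * t - 1}"
    then show "(\<Sum>\<^sub>\<infinity>p. T (h (k, p))) = (-1) powi k * q powi (binom2 k + k) * moment t m q k
      * hecke_f 1 (2 * t) (2 * t * (2 * t - 1)) (inverse x * q powi (k + 1)) (- (q powi ((k + t) * (2 * t - 1)))) q"
      by (subst residue_class_term[OF x]) (auto simp: T_def h_def intro!: infsum_cong)
  qed simp
  finally show ?thesis .
qed

section \<open>The values at the integer powers of the nome\<close>

text \<open>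
  On the annulus \<open>a < norm x < b\<close> a power of \<open>norm x\<close> is at most the sum of the corresponding powers
  of \<open>a\<close> and \<open>b\<close>, whatever the sign of the exponent, so the sum of two majorants dominates.
\<close>
lemma kernel_sum_tendsto:
  assumes z: "z \<noteq> 0"
  shows "(kernel_sum \<longlongrightarrow> kernel_sum z) (at z)"
  unfolding kernel_sum_def
proof (rule infsum_tendsto_dominated)
  define a b where "a = norm z / 2" and "b = norm z * 2"
  have ab: "0 < a" "a < norm z" "norm z < b"
    using z by (auto simp: a_def b_def)
  show "(\<lambda>p. kernel_majorant a moment_bound p + kernel_majorant b moment_bound p) summable_on UNIV"
    using ab moment_bound_nonneg by (intro summable_on_add kernel_majorant_summable) auto
  have nt: "((\<lambda>x. norm x) \<longlongrightarrow> norm z) (at z)"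
    by (intro tendsto_intros)
  have "\<forall>\<^sub>F x in at z. a < norm x" "\<forall>\<^sub>F x in at z. norm x < b"
    using order_tendstoD[OF nt] ab by auto
  then show "\<forall>\<^sub>F x in at z. \<forall>p\<in>UNIV. norm (case p of (r, l) \<Rightarrow> sg2 r l * kernel x q r l * moment t m q l)
      \<le> kernel_majorant a moment_bound p + kernel_majorant b moment_bound p"
  proof eventually_elim
    case (elim x)
    have x: "x \<noteq> 0"
      using elim ab by auto
    have pw: "norm x powi (- r) \<le> a powi (- r) + b powi (- r)" for r
    proof (cases "r \<ge> 0")
      case True
      then have "norm x powi (- r) \<le> a powi (- r)"
        using elim ab by (simp add: power_int_minus power_int_mono le_imp_inverse_le)
      then show ?thesis
        using elim ab by (simp add: add_increasing2)
    next
      case False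
      then have "norm x powi (- r) \<le> b powi (- r)"
        using elim ab by (intro power_int_mono) auto
      then show ?thesis
        using elim ab by (simp add: add_increasing)
    qed
    show ?case
    proof
      fix p :: "int \<times> int"
      obtain r l where p: "p = (r, l)"
        by force
      have "norm (sg2 r l * kernel x q r l * moment t m q l) \<le> kernel_majorant (norm x) moment_bound (r, l)"
        by (rule norm_kernel_le[OF norm_moment_le x])
      also have "\<dots> = norm x powi (- r) * (norm q powi binom2 (r + 1) * (moment_bound * \<rho> ^ nat \<bar>l\<bar>))"
        by (simp add: kernel_majorant_def)
      also have "\<dots> \<le> (a powi (- r) + b powi (- r)) * (norm q powi binom2 (r + 1) * (moment_bound * \<rho> ^ nat \<bar>l\<bar>))"
        using \<rho> moment_bound_nonneg by (intro mult_right_mono pw) auto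
      finally show "norm (case p of (r, l) \<Rightarrow> sg2 r l * kernel x q r l * moment t m q l)
          \<le> kernel_majorant a moment_bound p + kernel_majorant b moment_bound p"
        by (simp add: p kernel_majorant_def algebra_simps)
    qed
  qed
  show "((\<lambda>x. case p of (r, l) \<Rightarrow> sg2 r l * kernel x q r l * moment t m q l)
      \<longlongrightarrow> (case p of (r, l) \<Rightarrow> sg2 r l * kernel z q r l * moment t m q l)) (at z)" for p :: "int \<times> int"
    using z by (auto simp: kernel_def split: prod.split intro!: tendsto_intros)
qed simp

lemma f_raw_eq:
  assumes "x \<noteq> 0" "x \<notin> range (\<lambda>n::int. q powi n)"
  shows "f_raw t m q x = kernel_sum x / qpoch_inf q q ^ 3"
proof -
  have "1 - x * q powi n \<noteq> 0" for n
  proof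
    assume "1 - x * q powi n = 0"
    then have "x = q powi (- n)"
      using q0 by (simp add: power_int_minus field_simps)
    with assms show False
      by blast
  qed
  from theta_times_g_sum[OF assms(1) this] show ?thesis
    by (simp add: f_raw_def)
qed

lemma powers_isolated:
  "\<forall>\<^sub>F x in at (q powi N). x \<notin> range (\<lambda>n::int. q powi n)"
proof -
  have nt: "((\<lambda>x. norm x) \<longlongrightarrow> norm q powi N) (at (q powi N))"
    unfolding norm_power_int[symmetric] by (intro tendsto_intros)
  have "\<forall>\<^sub>F x in at (q powi N). norm q powi (N + 1) < norm x"
    using q by (intro order_tendstoD(1)[OF nt] power_int_strict_decreasing) auto
  moreover have "\<forall>\<^sub>F x in at (q powi N). norm x < norm q powi (N - 1)"
    using q by (intro order_tendstoD(2)[OF nt] power_int_strict_decreasing) auto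
  moreover have "\<forall>\<^sub>F x in at (q powi N). x \<noteq> q powi N"
    by (rule eventually_neq_at_within)
  ultimately show ?thesis
  proof eventually_elim
    case (elim x)
    show ?case
    proof
      assume "x \<in> range (\<lambda>n::int. q powi n)"
      then obtain n where x: "x = q powi n"
        by blast
      have "\<not> N + 1 \<le> n"
        using elim(1) q power_int_decreasing[of "N + 1" n "norm q"] by (auto simp: x norm_power_int)
      moreover have "\<not> n \<le> N - 1"
        using elim(2) q power_int_decreasing[of n "N - 1" "norm q"] by (auto simp: x norm_power_int)
      ultimately show False
        using elim(3) x by (metis add1_zle_eq linorder_neqE zle_diff1_eq)
    qed
  qed
qed

lemma f_ext_eq:
  assumes x: "x \<noteq> 0"
  shows "f_ext t m q x = kernel_sum x / qpoch_inf q q ^ 3"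
proof (cases "x \<in> range (\<lambda>n::int. q powi n)")
  case True
  then obtain N where N: "x = q powi N"
    by blast
  have "((\<lambda>y. kernel_sum y / qpoch_inf q q ^ 3) \<longlongrightarrow> kernel_sum x / qpoch_inf q q ^ 3) (at x)"
    by (intro tendsto_divide kernel_sum_tendsto[OF x] tendsto_const) (simp add: qpoch_inf_self_neq_0[OF q])
  moreover have "\<forall>\<^sub>F y in at x. kernel_sum y / qpoch_inf q q ^ 3 = f_raw t m q y"
    using powers_isolated[of N, folded N] eventually_neq_at_within[of 0 x UNIV]
    by eventually_elim (simp add: f_raw_eq)
  ultimately have "(f_raw t m q \<longlongrightarrow> kernel_sum x / qpoch_inf q q ^ 3) (at x)"
    by (rule Lim_transform_eventually)
  then show ?thesis
    using True by (simp add: f_ext_def remove_sings_eqI)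
next
  case False
  then show ?thesis
    by (simp add: f_ext_def f_raw_eq[OF x False])
qed

end

section \<open>The double-sum identity\<close>

theorem corollary1p7:
  fixes q x :: complex and t m :: int
  assumes "0 < norm q" and "norm q < 1"
    and "t \<ge> 2" and "1 \<le> m" and "m < t"
    and "x \<noteq> 0"
  shows "qpoch_inf q q ^ 3 * f_ext t m q x =
    (\<Sum>k = 0..2*t - 1. (-1) powi k * q powi (binom2 k + k)
       * (hecke_f 1 (4*t - 1) 1 (q powi (2*t + k - m)) (q powi (1 + m + k)) q
          + q powi (2*t + k)
            * hecke_f 1 (4*t - 1) 1 (q powi (4*t + k - m)) (q powi (2*t + m + k + 1)) q)
       * hecke_f 1 (2*t) (2*t * (2*t - 1))
           (inverse x * q powi (k + 1)) (- (q powi ((k + t) * (2*t - 1)))) q)"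
proof -
  interpret theta_params q t m
    using assms by unfold_locales auto
  have "qpoch_inf q q ^ 3 * f_ext t m q x = kernel_sum x"
    using f_ext_eq[OF assms(6)] qpoch_inf_self_neq_0[OF assms(1,2)] by simp
  also note kernel_sum_eq_hecke[OF assms(6)]
  finally show ?thesis
    unfolding moment_eq_hecke .
qed

end
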